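(* Let $r\ge2$ and $2\le s\le r$ be integers. There exist $\delta_0>0$ and $n_0$ such that for all $n\ge n_0$ and $0<\delta\le\delta_0$ the following holds: if $G$ is a graph on $n$ vertices containing no copy of $K_{r+1}$ and $k_s(G)\ge\binom rs\left(\frac nr\right)^s-\delta n^s$, then $$D_r(G)\le\left(\frac{2r}{3\sqrt3}+o_\delta(1)\right)\frac{\binom r2^{3/2}}{\binom rs^{3/s}}\,\delta^{3/s}n^2,$$ where $o_\delta(1)$ denotes a term (depending only on $r,s,\delta$) that tends to $0$ as $\delta\to0$.
   Context: $K_{m}$ is the complete graph on $m$ vertices; $k_s(G)$ is the number of copies of $K_s$ in $G$. $D_r(G)$ is the minimum number of edges that must be removed from $G$ to make it $r$-partite (i.e. $r$-colorable). *)

theory Defs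
  imports Complex_Main
begin

definition graph_on :: "nat \<Rightarrow> nat set set \<Rightarrow> bool" where
  "graph_on n E \<longleftrightarrow> (\<forall>e\<in>E. e \<subseteq> {0..<n} \<and> card e = 2)"

definition is_clique :: "nat set set \<Rightarrow> nat set \<Rightarrow> bool" where
  "is_clique E K \<longleftrightarrow> (\<forall>u\<in>K. \<forall>v\<in>K. u \<noteq> v \<longrightarrow> {u, v} \<in> E)"

definition k_count :: "nat \<Rightarrow> nat \<Rightarrow> nat set set \<Rightarrow> nat" where
  "k_count n s E = card {K. K \<subseteq> {0..<n} \<and> card K = s \<and> is_clique E K}"

definition Kfree :: "nat \<Rightarrow> nat \<Rightarrow> nat set set \<Rightarrow> bool" where
  "Kfree n m E \<longleftrightarrow> \<not> (\<exists>K. K \<subseteq> {0..<n} \<and> card K = m \<and> is_clique E K)"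

definition r_partite :: "nat \<Rightarrow> nat \<Rightarrow> nat set set \<Rightarrow> bool" where
  "r_partite n r E \<longleftrightarrow> (\<exists>c :: nat \<Rightarrow> nat. (\<forall>v\<in>{0..<n}. c v < r) \<and>
      (\<forall>e\<in>E. \<forall>u\<in>e. \<forall>v\<in>e. u \<noteq> v \<longrightarrow> c u \<noteq> c v))"

definition D_r :: "nat \<Rightarrow> nat \<Rightarrow> nat set set \<Rightarrow> nat" where
  "D_r n r E = Min {card F | F. F \<subseteq> E \<and> r_partite n r (E - F)}"

end

theory Submission
  imports Defs "HOL-Analysis.Convex"
begin

text \<open>By the Moon--Moser inequalities, \<open>k\<^sub>s\<close> close to its maximum forces the number of edges to be
  within \<open>O(\<delta>) n\<^sup>2\<close> of its maximum, with constant 1 for \<open>s = 2\<close>.  So assume that \<open>G\<close> has at least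
  \<open>(1 - 1/r) n\<^sup>2 / 2 - \<eta>\<^sup>2 n\<^sup>2\<close> edges, \<open>\<eta> = sqrt \<delta>\<close>, and take an \<open>r\<close>-colouring with the fewest inner
  (monochromatic) edges.  Fueredi's argument bounds these by \<open>\<eta>\<^sup>2 n\<^sup>2\<close>, so few pairs between classes
  are missing and the classes are nearly balanced.  Up to lower order, the inner edges are incident
  to some \<open>b n = O(\<eta>\<^sup>2) n\<close> vertices, each having no neighbour in almost an entire other class.  If
  \<open>x n\<close> is the largest inner degree among them, that vertex has at least \<open>x n\<close> neighbours in every
  class and no \<open>K\<^sub>r\<close> among these, which costs \<open>x\<^sup>2 n\<^sup>2\<close> further missing pairs.  Hence
  \<open>b / r + x\<^sup>2 \<le> (1 + o(1)) \<eta>\<^sup>2\<close>, while there are at most about \<open>b x n\<^sup>2\<close> inner edges; maximising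
  \<open>b x\<close> gives the constant \<open>2 r / (3 sqrt 3)\<close>.\<close>

section \<open>Counting ordered pairs under a relation\<close>

text \<open>Edges, inner edges and missing pairs are all counted as ordered pairs, that is, twice.\<close>

definition pair_count :: "('a \<Rightarrow> 'b \<Rightarrow> bool) \<Rightarrow> 'a set \<Rightarrow> 'b set \<Rightarrow> nat" where
  "pair_count R S T = (\<Sum>u\<in>S. card {v \<in> T. R u v})"

lemma pair_count_eq_card:
  assumes "finite S" "finite T"
  shows "pair_count R S T = card {(u, v). u \<in> S \<and> v \<in> T \<and> R u v}"
proof -
  have "{(u, v). u \<in> S \<and> v \<in> T \<and> R u v} = (SIGMA u:S. {v \<in> T. R u v})" by auto
  then show ?thesis using assms by (simp add: pair_count_def)
qed

lemma pair_count_Un_left: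
  assumes "finite S" "finite S'" "S \<inter> S' = {}"
  shows "pair_count R (S \<union> S') T = pair_count R S T + pair_count R S' T"
  using assms by (simp add: pair_count_def sum.union_disjoint)

lemma pair_count_Un_right:
  assumes "finite T" "finite T'" "T \<inter> T' = {}"
  shows "pair_count R S (T \<union> T') = pair_count R S T + pair_count R S T'"
proof -
  have "card {v \<in> T \<union> T'. R u v} = card {v \<in> T. R u v} + card {v \<in> T'. R u v}" for u
  proof -
    have "{v \<in> T \<union> T'. R u v} = {v \<in> T. R u v} \<union> {v \<in> T'. R u v}" by auto
    then show ?thesis using assms by (simp add: card_Un_disjoint disjoint_iff)
  qed
  then show ?thesis by (simp add: pair_count_def sum.distrib)
qed

lemma pair_count_commute:
  assumes "finite S" "finite T" "symp R"
  shows "pair_count R S T = pair_count R T S"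
proof -
  have "bij_betw prod.swap {(u, v). u \<in> S \<and> v \<in> T \<and> R u v} {(u, v). u \<in> T \<and> v \<in> S \<and> R u v}"
    using assms(3) by (auto simp: bij_betw_def inj_on_def image_iff dest: sympD)
  then show ?thesis using assms by (simp add: pair_count_eq_card bij_betw_same_card)
qed

lemma pair_count_le:
  assumes "finite T"
  shows "pair_count R S T \<le> card S * card T"
proof -
  have "pair_count R S T \<le> (\<Sum>u\<in>S. card T)"
    unfolding pair_count_def by (intro sum_mono card_mono) (use assms in auto)
  then show ?thesis by simp
qed

lemma pair_count_cong:
  assumes "\<And>u v. u \<in> S \<Longrightarrow> v \<in> T \<Longrightarrow> R u v \<longleftrightarrow> R' u v"
  shows "pair_count R S T = pair_count R' S T"
  unfolding pair_count_def by (intro sum.cong arg_cong[where f = card]) (use assms in auto)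

lemma pair_count_disj:
  assumes "finite S" "finite T" "\<And>u v. u \<in> S \<Longrightarrow> v \<in> T \<Longrightarrow> \<not> (R u v \<and> R' u v)"
  shows "pair_count (\<lambda>u v. R u v \<or> R' u v) S T = pair_count R S T + pair_count R' S T"
proof -
  have "card {v \<in> T. R u v \<or> R' u v} = card {v \<in> T. R u v} + card {v \<in> T. R' u v}" if "u \<in> S" for u
  proof -
    have "{v \<in> T. R u v \<or> R' u v} = {v \<in> T. R u v} \<union> {v \<in> T. R' u v}" by auto
    moreover have "{v \<in> T. R u v} \<inter> {v \<in> T. R' u v} = {}" using assms(3)[OF that] by auto
    ultimately show ?thesis using assms by (simp add: card_Un_disjoint)
  qed
  then show ?thesis by (simp add: pair_count_def sum.distrib)
qed

lemma pair_count_Un_square: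
  assumes "finite S" "finite T" "S \<inter> T = {}" "symp R"
  shows "pair_count R (S \<union> T) (S \<union> T)
    = pair_count R S S + 2 * pair_count R S T + pair_count R T T"
  using assms
  by (simp add: pair_count_Un_left pair_count_Un_right pair_count_commute[of T S])

section \<open>Fueredi's stability colouring\<close>

text \<open>Fueredi's argument: the new colour class is the set of non-neighbours of a vertex of
  maximum degree, and every vertex of that class has degree at most the size of the rest.\<close>

lemma ex_colouring_few_inner_edges:
  fixes adj :: "'a \<Rightarrow> 'a \<Rightarrow> bool"
  assumes sym: "symp adj" and irr: "irreflp adj"
  shows "finite V \<Longrightarrow> \<forall>K\<subseteq>V. card K = Suc r \<longrightarrow> \<not> pairwise adj K \<Longrightarrow>
    \<exists>c :: 'a \<Rightarrow> nat. (\<forall>v\<in>V. c v < r) \<and>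
      pair_count adj V V + pair_count (\<lambda>u v. adj u v \<and> c u = c v) V V
        \<le> pair_count (\<lambda>u v. c u \<noteq> c v) V V"
proof (induction r arbitrary: V)
  case 0
  have "V = {}"
  proof (rule ccontr)
    assume "V \<noteq> {}"
    then obtain x where "x \<in> V" by auto
    with 0(2)[rule_format, of "{x}"] show False by simp
  qed
  then show ?case by (simp add: pair_count_def)
next
  case (Suc r)
  show ?case
  proof (cases "V = {}")
    case True
    then show ?thesis by (simp add: pair_count_def)
  next
    case False
    define d where "d v = card {w \<in> V. adj v w}" for v
    have "Max (d ` V) \<in> d ` V" using False Suc.prems by (intro Max_in) auto
    then obtain x where x: "x \<in> V" "d x = Max (d ` V)" by auto
    have dmax: "d v \<le> d x" if "v \<in> V" for v
      using that Suc.prems x by simp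
    define U where "U = {w \<in> V. adj x w}"
    define W where "W = V - U"
    have fin: "finite U" "finite W" using Suc.prems by (auto simp: U_def W_def)
    have VUW: "V = U \<union> W" "U \<inter> W = {}" by (auto simp: U_def W_def)
    have "\<not> pairwise adj K" if K: "K \<subseteq> U" "card K = Suc r" for K
    proof
      assume pw: "pairwise adj K"
      have "x \<notin> U" using irr by (auto simp: U_def irreflp_def)
      then have "card (insert x K) = Suc (Suc r)" using K fin finite_subset by (subst card_insert_disjoint) auto
      moreover have "insert x K \<subseteq> V" using K x by (auto simp: U_def)
      moreover have "pairwise adj (insert x K)"
        using pw K sym by (auto simp: pairwise_insert U_def dest: sympD)
      ultimately show False using Suc.prems(2) by blast
    qed
    then obtain c :: "'a \<Rightarrow> nat" where c: "\<forall>v\<in>U. c v < r"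
      "pair_count adj U U + pair_count (\<lambda>u v. adj u v \<and> c u = c v) U U
        \<le> pair_count (\<lambda>u v. c u \<noteq> c v) U U"
      using Suc.IH[of U] fin by blast
    define c' where "c' v = (if v \<in> U then c v else r)" for v
    have WU: "v \<notin> U" if "v \<in> W" for v using that by (simp add: W_def)
    have cU: "c' v = c v" if "v \<in> U" for v using that by (simp add: c'_def)
    have cW: "c' v = r" if "v \<in> W" for v using that WU by (simp add: c'_def)
    have ne: "c' u \<noteq> c' w" if "u \<in> U" "w \<in> W" for u w using that c cU cW by fastforce
    have sym1: "symp (\<lambda>u v. adj u v \<and> c' u = c' v)" "symp (\<lambda>u v. c' u \<noteq> c' v)"
      using sym by (auto simp: symp_def)
    have deg: "pair_count adj W V \<le> card W * card U"
    proof -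
      have "pair_count adj W V \<le> (\<Sum>w\<in>W. d x)"
        unfolding pair_count_def by (intro sum_mono) (use dmax VUW in \<open>auto simp: d_def\<close>)
      then show ?thesis by (simp add: d_def U_def)
    qed
    have deg': "pair_count adj U W + pair_count adj W W \<le> card W * card U"
      using deg fin VUW by (simp add: pair_count_Un_right pair_count_commute[OF _ _ sym, of U W])
    have I: "pair_count (\<lambda>u v. adj u v \<and> c' u = c' v) V V =
       pair_count (\<lambda>u v. adj u v \<and> c u = c v) U U + pair_count adj W W"
    proof -
      have "pair_count (\<lambda>u v. adj u v \<and> c' u = c' v) U W = pair_count (\<lambda>_ _. False) U W"
        by (intro pair_count_cong) (use ne in auto)
      moreover have "pair_count (\<lambda>u v. adj u v \<and> c' u = c' v) U U
          = pair_count (\<lambda>u v. adj u v \<and> c u = c v) U U"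
        by (intro pair_count_cong) (use cU in auto)
      moreover have "pair_count (\<lambda>u v. adj u v \<and> c' u = c' v) W W = pair_count adj W W"
        by (intro pair_count_cong) (use cW in auto)
      ultimately show ?thesis
        using pair_count_Un_square[OF fin VUW(2) sym1(1)] VUW(1) by (simp add: pair_count_def)
    qed
    have X: "pair_count (\<lambda>u v. c' u \<noteq> c' v) V V =
       pair_count (\<lambda>u v. c u \<noteq> c v) U U + 2 * (card U * card W)"
    proof -
      have "pair_count (\<lambda>u v. c' u \<noteq> c' v) U W = pair_count (\<lambda>_ _. True) U W"
        by (intro pair_count_cong) (use ne in auto)
      moreover have "pair_count (\<lambda>u v. c' u \<noteq> c' v) U U = pair_count (\<lambda>u v. c u \<noteq> c v) U U"
        by (intro pair_count_cong) (use cU in auto)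
      moreover have "pair_count (\<lambda>u v. c' u \<noteq> c' v) W W = pair_count (\<lambda>_ _. False) W W"
        by (intro pair_count_cong) (use cW in auto)
      ultimately show ?thesis
        using pair_count_Un_square[OF fin VUW(2) sym1(2)] VUW(1) by (simp add: pair_count_def)
    qed
    have E: "pair_count adj V V = pair_count adj U U + 2 * pair_count adj U W + pair_count adj W W"
      using pair_count_Un_square[OF fin VUW(2) sym] VUW(1) by simp
    \<comment> \<open>Compared with \<open>U\<close>, the left side grows by twice the edges from
      \<open>W\<close> to \<open>U\<close> and within \<open>W\<close>, the right side by
      \<open>2 * card U * card W\<close>; \<open>deg'\<close> compares the two.\<close>
    have "pair_count adj V V + pair_count (\<lambda>u v. adj u v \<and> c' u = c' v) V V
        \<le> pair_count (\<lambda>u v. c' u \<noteq> c' v) V V"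
      unfolding I X E using c(2) deg' by (simp add: mult.commute)
    moreover have "\<forall>v\<in>V. c' v < Suc r" using c(1) by (auto simp: c'_def less_SucI)
    ultimately show ?thesis by blast
  qed
qed

section \<open>Missing pairs forced by the absence of a transversal clique\<close>

text \<open>Each of the \<open>m ^ card J\<close> transversals of the sets \<open>N j\<close>
  contains a missing pair, and a missing pair lies in at most \<open>m ^ (card J - 2)\<close>
  transversals. So there are at least \<open>m\<^sup>2\<close> missing pairs; the factor 2 comes
  from counting both orders.\<close>

lemma missing_pairs_of_no_transversal_clique:
  fixes c :: "'a \<Rightarrow> nat"
  assumes sym: "symp adj" and J: "finite J"
    and N: "\<And>j. j \<in> J \<Longrightarrow> finite (N j) \<and> card (N j) = m" "\<And>j v. j \<in> J \<Longrightarrow> v \<in> N j \<Longrightarrow> c v = j"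
    and U: "(\<Union>j\<in>J. N j) \<subseteq> U" "finite U"
    and no: "\<And>K. K \<subseteq> (\<Union>j\<in>J. N j) \<Longrightarrow> card K = card J \<Longrightarrow> \<not> pairwise adj K"
  shows "2 * m\<^sup>2 \<le> pair_count (\<lambda>u v. c u \<noteq> c v \<and> \<not> adj u v) U U"
proof -
  define S where "S = (\<Union>j\<in>J. N j)"
  have finS: "finite S" using N J by (auto simp: S_def)
  \<comment> \<open>The condition \<open>c u < c v\<close> picks one orientation of each missing
    pair; \<open>F p\<close> collects the transversals through \<open>p\<close>.\<close>
  define H where "H = {(u, v). u \<in> S \<and> v \<in> S \<and> c u < c v \<and> \<not> adj u v}"
  have finH: "finite H"
    by (rule finite_subset[of _ "S \<times> S"]) (use finS in \<open>auto simp: H_def\<close>)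
  define F where "F p = {f \<in> PiE J N. f (c (fst p)) = fst p \<and> f (c (snd p)) = snd p}" for p
  have finP: "finite (PiE J N)" using J N by (intro finite_PiE) auto
  have cov: "PiE J N \<subseteq> (\<Union>p\<in>H. F p)"
  proof
    fix f assume f: "f \<in> PiE J N"
    have fN: "f j \<in> N j" "c (f j) = j" if "j \<in> J" for j using f N that by (auto simp: PiE_def Pi_def)
    have "inj_on f J" using fN by (metis inj_onI)
    then have "card (f ` J) = card J" by (rule card_image)
    moreover have "f ` J \<subseteq> (\<Union>j\<in>J. N j)" using fN by auto
    ultimately have "\<not> pairwise adj (f ` J)" using no by blast
    then obtain i j where ij: "i \<in> J" "j \<in> J" "f i \<noteq> f j" "\<not> adj (f i) (f j)"
      by (auto simp: pairwise_def)
    then have "i \<noteq> j" by auto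
    have "\<exists>p\<in>H. f \<in> F p" if "i < j" "i \<in> J" "j \<in> J" "\<not> adj (f i) (f j)" for i j
      using that fN f by (intro bexI[of _ "(f i, f j)"]) (auto simp: H_def S_def F_def)
    moreover have "\<not> adj (f j) (f i)" using ij sym by (auto dest: sympD)
    ultimately show "f \<in> (\<Union>p\<in>H. F p)" using \<open>i \<noteq> j\<close> ij
      by (metis UN_iff linorder_neqE_nat)
  qed
  have Fle: "card (F p) \<le> m ^ (card J - 2) \<and> 2 \<le> card J" if "p \<in> H" for p
  proof -
    obtain u v where p: "p = (u, v)" by (cases p)
    define J' where "J' = J - {c u, c v}"
    have uv: "c u \<in> J" "c v \<in> J" "c u \<noteq> c v" using that p N by (auto simp: H_def S_def)
    have J': "card J' = card J - 2" using uv J by (simp add: J'_def card_Diff_subset)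
    have "card {c u, c v} \<le> card J" using uv J by (intro card_mono) auto
    then have 2: "2 \<le> card J" using uv by simp
    \<comment> \<open>A transversal through \<open>p\<close> is fixed at the two colours of
      \<open>p\<close>, so its values on \<open>J'\<close> determine it.\<close>
    have "inj_on (\<lambda>f. restrict f J') (F p)"
    proof (rule inj_onI)
      fix f g assume fg: "f \<in> F p" "g \<in> F p" "restrict f J' = restrict g J'"
      have "f x = g x" for x
      proof (cases "x \<in> J'")
        case True then show ?thesis using fg(3) by (metis restrict_apply')
      next
        case False
        then show ?thesis using fg(1,2) p by (auto simp: F_def J'_def PiE_def extensional_def)
      qed
      then show "f = g" by auto
    qed
    moreover have "(\<lambda>f. restrict f J') ` F p \<subseteq> PiE J' N" by (auto simp: F_def J'_def PiE_def Pi_def)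
    ultimately have "card (F p) \<le> card (PiE J' N)"
      using J N by (intro card_inj_on_le finite_PiE) (auto simp: J'_def)
    also have "\<dots> = m ^ card J'"
      using J N by (subst card_PiE) (auto simp: J'_def)
    finally show ?thesis using J' 2 by simp
  qed
  have "m ^ card J = card (PiE J N)" using J N by (subst card_PiE) auto
  also have "\<dots> \<le> card (\<Union>p\<in>H. F p)"
    using cov finH by (intro card_mono) (auto simp: F_def finP)
  also have "\<dots> \<le> (\<Sum>p\<in>H. card (F p))" by (rule card_UN_le[OF finH])
  finally have le: "m ^ card J \<le> (\<Sum>p\<in>H. card (F p))" .
  have "m\<^sup>2 \<le> card H"
  \<comment> \<open>An empty \<open>H\<close> forces \<open>m = 0\<close> by \<open>le\<close>.
    Otherwise the positive power of \<open>m\<close> can be cancelled.\<close>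
  proof (cases "m = 0 \<or> H = {}")
    case True
    then show ?thesis using le by auto
  next
    case False
    then have 2: "2 \<le> card J" and m: "m > 0" using Fle by auto
    have "m\<^sup>2 * m ^ (card J - 2) = m ^ card J"
      using 2 by (metis le_add_diff_inverse power_add)
    also have "\<dots> \<le> card H * m ^ (card J - 2)"
      using le sum_bounded_above[of H "\<lambda>p. card (F p)" "m ^ (card J - 2)"] Fle by fastforce
    finally show ?thesis using m by simp
  qed
  moreover have "2 * card H \<le> pair_count (\<lambda>u v. c u \<noteq> c v \<and> \<not> adj u v) U U"
  proof -
    have sw: "card (prod.swap ` H) = card H" by (intro card_image) (auto simp: inj_on_def)
    have "card H + card (prod.swap ` H) = card (H \<union> prod.swap ` H)"
      using finH by (subst card_Un_disjoint) (auto simp: H_def)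
    also have "\<dots> \<le> card {(u, v). u \<in> U \<and> v \<in> U \<and> c u \<noteq> c v \<and> \<not> adj u v}"
    proof (rule card_mono)
      show "finite {(u, v). u \<in> U \<and> v \<in> U \<and> c u \<noteq> c v \<and> \<not> adj u v}"
        by (rule finite_subset[of _ "U \<times> U"]) (use U in auto)
      show "H \<union> prod.swap ` H \<subseteq> {(u, v). u \<in> U \<and> v \<in> U \<and> c u \<noteq> c v \<and> \<not> adj u v}"
        using U sym by (auto simp: H_def S_def dest: sympD)
    qed
    finally show ?thesis using sw U by (simp add: pair_count_eq_card)
  qed
  ultimately show ?thesis by simp
qed

section \<open>Clique counts and the Moon--Moser inequalities\<close>

definition cliques :: "('a \<Rightarrow> 'a \<Rightarrow> bool) \<Rightarrow> 'a set \<Rightarrow> nat \<Rightarrow> 'a set set" where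
  "cliques adj V s = {K. K \<subseteq> V \<and> card K = s \<and> pairwise adj K}"

definition common_nbrs :: "('a \<Rightarrow> 'a \<Rightarrow> bool) \<Rightarrow> 'a set \<Rightarrow> 'a set \<Rightarrow> 'a set" where
  "common_nbrs adj V K = {v \<in> V. \<forall>u\<in>K. adj u v}"

lemma finite_cliques: "finite V \<Longrightarrow> finite (cliques adj V s)"
  by (rule finite_subset[of _ "Pow V"]) (auto simp: cliques_def)

text \<open>Double counting: a clique with a vertex extending it is the same as a clique of the next
  size with a marked vertex. The weight \<open>g\<close> allows both sums of degrees
  (\<open>g = 1\<close>) and sums of squared degrees.\<close>

lemma sum_cliques_common_nbrs:
  fixes g :: "'a set \<Rightarrow> 'a \<Rightarrow> real"
  assumes sym: "symp adj" and irr: "irreflp adj" and V: "finite V"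
  shows "(\<Sum>B\<in>cliques adj V s. \<Sum>v\<in>common_nbrs adj V B. g B v)
    = (\<Sum>A\<in>cliques adj V (Suc s). \<Sum>a\<in>A. g (A - {a}) a)"
proof -
  have fB: "finite (common_nbrs adj V B)" for B using V by (simp add: common_nbrs_def)
  have fA: "finite A" if "A \<in> cliques adj V t" for A t
    using that V by (auto simp: cliques_def intro: finite_subset)
  have notin: "v \<notin> B" if "v \<in> common_nbrs adj V B" for v B
    using that irr by (auto simp: common_nbrs_def irreflp_def)
  have ins: "insert v B \<in> cliques adj V (Suc s)"
    if B: "B \<in> cliques adj V s" and v: "v \<in> common_nbrs adj V B" for B v
  proof -
    have "card (insert v B) = Suc s" using B fA[OF B] notin[OF v] by (simp add: cliques_def)
    moreover have "insert v B \<subseteq> V" using B v by (auto simp: cliques_def common_nbrs_def)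
    moreover have "pairwise adj (insert v B)"
      using B v sym by (auto simp: cliques_def common_nbrs_def pairwise_insert dest: sympD)
    ultimately show ?thesis by (simp add: cliques_def)
  qed
  have rem: "A - {a} \<in> cliques adj V s" "a \<in> common_nbrs adj V (A - {a})"
    if A: "A \<in> cliques adj V (Suc s)" and a: "a \<in> A" for A a
  proof -
    have "card (A - {a}) = s" using A a fA[OF A] by (simp add: cliques_def)
    moreover have "A - {a} \<subseteq> V" using A by (auto simp: cliques_def)
    moreover have "pairwise adj (A - {a})"
      using A by (auto simp: cliques_def intro: pairwise_mono)
    ultimately show "A - {a} \<in> cliques adj V s" by (simp add: cliques_def)
    show "a \<in> common_nbrs adj V (A - {a})"
      using A a by (auto simp: cliques_def common_nbrs_def pairwise_def)
  qed
  have "(\<Sum>B\<in>cliques adj V s. \<Sum>v\<in>common_nbrs adj V B. g B v)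
      = (\<Sum>(B, v)\<in>(SIGMA B:cliques adj V s. common_nbrs adj V B). g B v)"
    using fB finite_cliques[OF V] by (intro sum.Sigma) auto
  also have "\<dots> = (\<Sum>(A, a)\<in>(SIGMA A:cliques adj V (Suc s). A). g (A - {a}) a)"
    by (rule sum.reindex_bij_witness[where i = "\<lambda>(A, a). (A - {a}, a)"
          and j = "\<lambda>(B, v). (insert v B, v)"]) (auto simp: ins rem notin insert_absorb)
  also have "\<dots> = (\<Sum>A\<in>cliques adj V (Suc s). \<Sum>a\<in>A. g (A - {a}) a)"
    using fA finite_cliques[OF V] by (intro sum.Sigma[symmetric]) auto
  finally show ?thesis .
qed

lemma sum_card_common_nbrs:
  assumes "symp adj" and "irreflp adj" and V: "finite V"
  shows "(\<Sum>B\<in>cliques adj V s. real (card (common_nbrs adj V B)))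
    = real (Suc s) * real (card (cliques adj V (Suc s)))"
proof -
  have "(\<Sum>B\<in>cliques adj V s. real (card (common_nbrs adj V B)))
      = (\<Sum>A\<in>cliques adj V (Suc s). real (card A))"
    using sum_cliques_common_nbrs[OF assms, of "\<lambda>_ _. 1" s] by simp
  also have "\<dots> = (\<Sum>A\<in>cliques adj V (Suc s). real (Suc s))"
    by (intro sum.cong) (auto simp: cliques_def)
  finally show ?thesis by simp
qed

text \<open>A vertex adjacent to \<open>A - {a}\<close> for two different \<open>a\<close> is
  adjacent to all of \<open>A\<close>. So every vertex is counted at most once, except that common
  neighbours of \<open>A\<close> are counted at most \<open>s + 1\<close> times.\<close>

lemma sum_card_common_nbrs_remove:
  assumes V: "finite V" and A: "A \<in> cliques adj V (Suc s)"
  shows "(\<Sum>a\<in>A. real (card (common_nbrs adj V (A - {a}))))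
    \<le> real (card V) + real s * real (card (common_nbrs adj V A))"
proof -
  have fA: "finite A" and cA: "card A = Suc s" using A V by (auto simp: cliques_def intro: finite_subset)
  have one: "card {a \<in> A. v \<in> common_nbrs adj V (A - {a})}
      \<le> 1 + s * (if v \<in> common_nbrs adj V A then 1 else 0)" if "v \<in> V" for v
  proof (cases "v \<in> common_nbrs adj V A")
    case True
    have "card {a \<in> A. v \<in> common_nbrs adj V (A - {a})} \<le> card A"
      by (intro card_mono) (use fA in auto)
    then show ?thesis using True cA by simp
  next
    case False
    have "a = b" if "a \<in> A" "b \<in> A" "v \<in> common_nbrs adj V (A - {a})"
      "v \<in> common_nbrs adj V (A - {b})" for a b
      using that False by (auto simp: common_nbrs_def)
    then have "card {a \<in> A. v \<in> common_nbrs adj V (A - {a})} \<le> Suc 0"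
      using fA by (subst card_le_Suc0_iff_eq) auto
    then show ?thesis by simp
  qed
  have sub: "common_nbrs adj V K \<subseteq> V" for K by (auto simp: common_nbrs_def)
  have "(\<Sum>a\<in>A. card (common_nbrs adj V (A - {a})))
      = (\<Sum>a\<in>A. \<Sum>v\<in>V. if v \<in> common_nbrs adj V (A - {a}) then 1 else 0)"
    using V by (intro sum.cong) (simp_all add: sum.If_cases Int_absorb1[OF sub])
  also have "\<dots> = (\<Sum>v\<in>V. card {a \<in> A. v \<in> common_nbrs adj V (A - {a})})"
    by (subst sum.swap) (use fA in \<open>simp add: sum.If_cases Int_def\<close>)
  also have "\<dots> \<le> (\<Sum>v\<in>V. 1 + s * (if v \<in> common_nbrs adj V A then 1 else 0))"
    by (intro sum_mono one)
  also have "\<dots> = card V + s * card (common_nbrs adj V A)"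
    unfolding sum.distrib sum_distrib_left[symmetric]
    using V by (simp add: sum.If_cases Int_absorb1[OF sub])
  finally show ?thesis by (simp flip: of_nat_sum of_nat_mult of_nat_add)
qed

text \<open>Cauchy--Schwarz for the number of extensions of an \<open>s\<close>-clique: the sum of
  these numbers counts \<open>(s + 1)\<close>-cliques, and the sum of their squares regroups by
  \<open>(s + 1)\<close>-cliques into the quantities bounded in
  \<open>sum_card_common_nbrs_remove\<close>.\<close>

lemma moon_moser:
  assumes "symp adj" and "irreflp adj" and V: "finite V"
  shows "(real (Suc s) * card (cliques adj V (Suc s)))\<^sup>2 \<le> card (cliques adj V s) *
    (card V * card (cliques adj V (Suc s)) + s * real (Suc (Suc s)) * card (cliques adj V (Suc (Suc s))))"
proof -
  let ?d = "\<lambda>B. real (card (common_nbrs adj V B))"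
  have "(real (Suc s) * card (cliques adj V (Suc s)))\<^sup>2 = (\<Sum>B\<in>cliques adj V s. ?d B * 1)\<^sup>2"
    using sum_card_common_nbrs[OF assms, of s] by simp
  also have "\<dots> \<le> (\<Sum>B\<in>cliques adj V s. (?d B)\<^sup>2) * (\<Sum>B\<in>cliques adj V s. 1\<^sup>2)"
    by (rule Cauchy_Schwarz_ineq_sum)
  also have "(\<Sum>B\<in>cliques adj V s. (?d B)\<^sup>2)
      = (\<Sum>A\<in>cliques adj V (Suc s). \<Sum>a\<in>A. ?d (A - {a}))"
    using sum_cliques_common_nbrs[OF assms, of "\<lambda>B _. ?d B" s] by (simp add: power2_eq_square)
  also have "\<dots> \<le> (\<Sum>A\<in>cliques adj V (Suc s). card V + s * ?d A)"
    by (intro sum_mono sum_card_common_nbrs_remove V)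
  also have "\<dots> = card V * card (cliques adj V (Suc s)) + s * (\<Sum>A\<in>cliques adj V (Suc s). ?d A)"
    by (simp add: sum.distrib sum_distrib_left)
  also have "(\<Sum>A\<in>cliques adj V (Suc s). ?d A)
      = real (Suc (Suc s)) * card (cliques adj V (Suc (Suc s)))"
    by (rule sum_card_common_nbrs[OF assms])
  finally show ?thesis by (simp add: mult_ac mult_right_mono)
qed

text \<open>The ratio of consecutive clique counts is at most that in the balanced complete
  \<open>r\<close>-partite graph. Downward induction from \<open>s = r\<close>, where there is no
  larger clique: Moon--Moser turns a bound on one ratio into a bound on the preceding one.\<close>

lemma card_cliques_Suc_le:
  assumes "symp adj" and "irreflp adj" and "finite V"
    and free: "cliques adj V (Suc r) = {}" and "s \<le> r"
  shows "real (Suc s) * r * card (cliques adj V (Suc s))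
    \<le> real (r - s) * card V * card (cliques adj V s)"
  using \<open>s \<le> r\<close>
proof (induction s rule: inc_induct)
  case base
  show ?case using free by simp
next
  case (step s)
  define k0 k1 k2 n R S where defs: "k0 = real (card (cliques adj V s))"
    "k1 = real (card (cliques adj V (Suc s)))" "k2 = real (card (cliques adj V (Suc (Suc s))))"
    "n = real (card V)" "R = real r" "S = real s"
  have rs: "real (r - s) = R - S" "real (r - Suc s) = R - S - 1"
    using step.hyps by (auto simp: defs of_nat_diff)
  have nn: "k0 \<ge> 0" "k1 \<ge> 0" "S \<ge> 0" "R \<ge> 0" by (auto simp: defs)
  have IH: "(S + 2) * R * k2 \<le> (R - S - 1) * n * k1"
    using step.IH rs by (simp add: defs add_ac)
  have "((S + 1) * k1)\<^sup>2 \<le> k0 * (n * k1 + S * (S + 2) * k2)"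
    using moon_moser[OF assms(1-3), of s] by (simp add: defs add_ac)
  then have "R * ((S + 1) * k1)\<^sup>2 \<le> R * (k0 * (n * k1 + S * (S + 2) * k2))"
    using nn by (intro mult_left_mono)
  also have "\<dots> = k0 * (R * n * k1 + S * ((S + 2) * R * k2))" by (simp add: algebra_simps)
  also have "\<dots> \<le> k0 * (R * n * k1 + S * ((R - S - 1) * n * k1))"
    using nn IH by (intro mult_left_mono add_left_mono) auto
  also have "\<dots> = ((R - S) * n * k0) * ((S + 1) * k1)" by (simp add: algebra_simps)
  finally have "((S + 1) * R * k1) * ((S + 1) * k1) \<le> ((R - S) * n * k0) * ((S + 1) * k1)"
    by (simp add: power2_eq_square mult_ac)
  \<comment> \<open>Cancelling \<open>k1\<close> requires it to be nonzero; for
    \<open>k1 = 0\<close> the claim is just that the right side is nonnegative.\<close>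
  then have "(S + 1) * R * k1 \<le> (R - S) * n * k0" if "k1 \<noteq> 0"
    using that nn by (subst (asm) mult_le_cancel_right) (auto simp: zero_less_mult_iff)
  moreover have "0 \<le> (R - S) * n * k0" using rs(1) by (metis nn(1) defs(4) of_nat_0_le_iff mult_nonneg_nonneg)
  ultimately have "(S + 1) * R * k1 \<le> (R - S) * n * k0" by fastforce
  then show ?case using rs by (simp add: defs add_ac)
qed

text \<open>Multiply the ratio bounds for the sizes from 2 up to \<open>s\<close>. Equality holds
  for complete \<open>r\<close>-partite graphs with equal classes, so a deficit in
  \<open>s\<close>-cliques translates into an edge deficit without loss in the leading term.\<close>

lemma card_cliques_le_card_edges:
  assumes "symp adj" and "irreflp adj" and "finite V"
    and free: "cliques adj V (Suc r) = {}" and "2 \<le> s" "s \<le> r"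
  shows "real (card (cliques adj V s)) * (r choose 2)
    \<le> card (cliques adj V 2) * (r choose s) * (card V / r) ^ (s - 2)"
  using \<open>2 \<le> s\<close> \<open>s \<le> r\<close>
proof (induction s rule: dec_induct)
  case base
  show ?case by simp
next
  case (step s)
  define k where "k s = real (card (cliques adj V s))" for s
  have r: "r > 0" using step by simp
  have IH: "k s * (r choose 2) \<le> k 2 * (r choose s) * (card V / r) ^ (s - 2)"
    using step by (simp add: k_def)
  have "Suc s * (r choose Suc s) = (r - s) * (r choose s)"
    by (metis binomial_absorb_comp binomial_absorption)
  then have ch: "real (Suc s) * real (r choose Suc s) = real (r - s) * real (r choose s)"
    by (metis of_nat_mult)
  have "real (Suc s) * r * k (Suc s) \<le> real (r - s) * card V * k s"
    using card_cliques_Suc_le[OF assms(1-4), of s] step by (simp add: k_def)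
  then have "(real (Suc s) * r * k (Suc s)) * (r choose 2)
      \<le> (real (r - s) * card V * k s) * (r choose 2)" by (intro mult_right_mono) auto
  also have "\<dots> = (real (r - s) * card V) * (k s * (r choose 2))" by simp
  also have "\<dots> \<le> (real (r - s) * card V) * (k 2 * (r choose s) * (card V / r) ^ (s - 2))"
    by (intro mult_left_mono IH) auto
  also have "\<dots> = card V * k 2 * (real (r - s) * real (r choose s)) * (card V / r) ^ (s - 2)"
    by simp
  also have "\<dots> = (real (Suc s) * r) * (k 2 * (r choose Suc s) * (card V / r) ^ Suc (s - 2))"
    using r by (simp only: ch[symmetric]) (simp add: field_simps)
  finally have "(real (Suc s) * r) * (k (Suc s) * (r choose 2))
    \<le> (real (Suc s) * r) * (k 2 * (r choose Suc s) * (card V / r) ^ Suc (s - 2))"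
    by (simp only: mult_ac)
  then have "k (Suc s) * (r choose 2) \<le> k 2 * (r choose Suc s) * (card V / r) ^ Suc (s - 2)"
    using r by (subst (asm) mult_le_cancel_left_pos) auto
  moreover have "Suc (s - 2) = Suc s - 2" using step by simp
  ultimately show ?case by (simp add: k_def)
qed

section \<open>Locally optimal colourings\<close>

text \<open>Take a colouring with the fewest inner pairs: moving a single vertex to another class
  cannot help. As a consequence a vertex of inner degree \<open>x\<close> has at least
  \<open>x\<close> neighbours in every class.\<close>

lemma ex_locally_optimal_colouring:
  fixes adj :: "'a \<Rightarrow> 'a \<Rightarrow> bool" and c0 :: "'a \<Rightarrow> nat"
  assumes sym: "symp adj" and irr: "irreflp adj" and V: "finite V"
    and c0: "\<forall>v\<in>V. c0 v < r"
  shows "\<exists>c. (\<forall>v\<in>V. c v < r) \<and>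
    pair_count (\<lambda>u v. adj u v \<and> c u = c v) V V
      \<le> pair_count (\<lambda>u v. adj u v \<and> c0 u = c0 v) V V \<and>
    (\<forall>v\<in>V. \<forall>j<r. card {w \<in> V. adj v w \<and> c w = c v} \<le> card {w \<in> V. adj v w \<and> c w = j})"
proof -
  define I where "I c = pair_count (\<lambda>u v. adj u v \<and> c u = c v) V V" for c :: "'a \<Rightarrow> nat"
  obtain c where c: "\<forall>v\<in>V. c v < r" and min: "\<And>c'. \<forall>v\<in>V. c' v < r \<Longrightarrow> I c \<le> I c'"
    using ex_has_least_nat[of "\<lambda>c. \<forall>v\<in>V. c v < r" c0 I] c0 by blast
  have "card {w \<in> V. adj v w \<and> c w = c v} \<le> card {w \<in> V. adj v w \<and> c w = j}"
    if v: "v \<in> V" and j: "j < r" for v j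
  proof -
    define V' where "V' = V - {v}"
    have V': "V = {v} \<union> V'" "{v} \<inter> V' = {}" "finite V'" using v V by (auto simp: V'_def)
    \<comment> \<open>The factor 2 arises because every inner edge at \<open>v\<close> is counted in
      both orders; the last term does not depend on the colour of \<open>v\<close>.\<close>
    have split: "I d = 2 * card {w \<in> V. adj v w \<and> d w = d v}
        + pair_count (\<lambda>u v. adj u v \<and> d u = d v) V' V'" for d
    proof -
      have "symp (\<lambda>u v. adj u v \<and> d u = d v)" using sym by (auto simp: symp_def)
      note sq = pair_count_Un_square[OF _ V'(3,2) this]
      have "{w \<in> {v}. adj v w \<and> d v = d w} = {}" using irr by (auto simp: irreflp_def)
      moreover have "{w \<in> V'. adj v w \<and> d v = d w} = {w \<in> V. adj v w \<and> d w = d v}"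
        using irr by (auto simp: irreflp_def V'_def)
      ultimately show ?thesis using sq V'(1) by (simp add: I_def pair_count_def)
    qed
    have "I c \<le> I (c(v := j))" using c j by (intro min) auto
    moreover have "pair_count (\<lambda>u w. adj u w \<and> (c(v := j)) u = (c(v := j)) w) V' V'
        = pair_count (\<lambda>u v. adj u v \<and> c u = c v) V' V'"
      by (intro pair_count_cong) (auto simp: V'_def)
    moreover have "{w \<in> V. adj v w \<and> (c(v := j)) w = (c(v := j)) v} = {w \<in> V. adj v w \<and> c w = j}"
      using irr by (auto simp: irreflp_def)
    ultimately show ?thesis by (simp only: split)
  qed
  then show ?thesis using c min[OF c0] by (intro exI[of _ c]) (simp add: I_def)
qed

section \<open>Structure of a coloured graph without large cliques\<close>

text \<open>Nothing optimal is assumed of \<open>c\<close>, so that both Fueredi's colouring and the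
  improved one are instances.\<close>

locale clique_free_colouring =
  fixes V :: "'a set" and adj :: "'a \<Rightarrow> 'a \<Rightarrow> bool" and c :: "'a \<Rightarrow> nat" and r :: nat
  assumes fin: "finite V" and sym: "symp adj" and irr: "irreflp adj" and r2: "2 \<le> r"
    and free: "\<And>K. K \<subseteq> V \<Longrightarrow> card K = Suc r \<Longrightarrow> \<not> pairwise adj K"
    and col: "\<And>v. v \<in> V \<Longrightarrow> c v < r"
begin

definition miss :: "'a \<Rightarrow> 'a \<Rightarrow> bool" where "miss u v \<longleftrightarrow> c u \<noteq> c v \<and> \<not> adj u v"
definition inner :: "'a \<Rightarrow> 'a \<Rightarrow> bool" where "inner u v \<longleftrightarrow> adj u v \<and> c u = c v"
definition cls :: "nat \<Rightarrow> 'a set" where "cls j = {v \<in> V. c v = j}"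

lemma symp_miss: "symp miss" and symp_inner: "symp inner"
  using sym by (auto simp: symp_def miss_def inner_def)

lemma finite_cls: "finite (cls j)"
  using fin by (simp add: cls_def)

text \<open>A transversal clique in the common neighbourhood of \<open>Q\<close> would extend
  \<open>Q\<close> to a clique on \<open>r + 1\<close> vertices. Applied with an inner edge and the
  other \<open>r - 1\<close> classes, and with a single vertex and all \<open>r\<close>
  classes.\<close>

lemma missing_pairs_of_clique_extension:
  assumes Q: "Q \<subseteq> V" "pairwise adj Q" and J: "J \<subseteq> {..<r}" "card Q + card J = Suc r"
    and W: "W \<subseteq> V"
    and m: "\<And>j. j \<in> J \<Longrightarrow> m \<le> card {w \<in> cls j. w \<in> W \<and> (\<forall>u\<in>Q. adj u w)}"
  shows "2 * m\<^sup>2 \<le> pair_count miss W W"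
proof -
  let ?S = "\<lambda>j. {w \<in> cls j. w \<in> W \<and> (\<forall>u\<in>Q. adj u w)}"
  have "\<exists>N \<subseteq> ?S j. card N = m" if "j \<in> J" for j
    using obtain_subset_with_card_n[OF m[OF that]] by metis
  then have "\<exists>N. \<forall>j\<in>J. N j \<subseteq> ?S j \<and> card (N j) = m" by (intro bchoice) blast
  then obtain N where N': "\<forall>j\<in>J. N j \<subseteq> ?S j \<and> card (N j) = m" by (elim exE)
  have N: "N j \<subseteq> ?S j \<and> card (N j) = m" if "j \<in> J" for j by (rule bspec[OF N' that])
  have finN: "finite (N j)" if "j \<in> J" for j
    using N[OF that] finite_cls[of j] by (auto intro: finite_subset)
  have finQ: "finite Q" by (rule finite_subset[OF Q(1) fin])
  have "2 * m\<^sup>2 \<le> pair_count (\<lambda>u v. c u \<noteq> c v \<and> \<not> adj u v) W W"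
  proof (rule missing_pairs_of_no_transversal_clique[OF sym])
    show "finite J" by (rule finite_subset[OF J(1)]) simp
    show "finite (N j) \<and> card (N j) = m" if "j \<in> J" for j using N finN that by blast
    show "c v = j" if "j \<in> J" "v \<in> N j" for j v using N that by (auto simp: cls_def)
    show "(\<Union>j\<in>J. N j) \<subseteq> W" using N by blast
    show "finite W" by (rule finite_subset[OF W fin])
    show "\<not> pairwise adj K" if K: "K \<subseteq> (\<Union>j\<in>J. N j)" "card K = card J" for K
    proof
      assume pw: "pairwise adj K"
      have KQ: "adj u w" if "u \<in> Q" "w \<in> K" for u w using that K N by blast
      have KV: "K \<subseteq> V" using K N W by blast
      then have "finite K" using fin by (rule finite_subset)
      moreover have "Q \<inter> K = {}" using KQ irr by (auto simp: irreflp_def)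
      ultimately have "card (Q \<union> K) = Suc r" using finQ J K by (simp add: card_Un_disjoint)
      moreover have "pairwise adj (Q \<union> K)"
        using pw Q(2) KQ KQ[THEN sympD[OF sym]] by (auto simp: pairwise_def)
      ultimately show False using free[of "Q \<union> K"] Q KV by blast
    qed
  qed
  then show ?thesis by (simp add: miss_def[abs_def])
qed

text \<open>Take \<open>j\<close> as the other class with the fewest common neighbours of
  \<open>u\<close> and \<open>v\<close>; that number is then available in all \<open>r - 1\<close>
  other classes.\<close>

lemma inner_edge_few_common_nbrs:
  assumes "u \<in> V" "v \<in> V" "inner u v"
  shows "\<exists>j<r. j \<noteq> c u \<and> 2 * (card {w \<in> cls j. adj u w \<and> adj v w})\<^sup>2 \<le> pair_count miss V V"
proof -
  let ?d = "\<lambda>j. card {w \<in> cls j. adj u w \<and> adj v w}"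
  define J where "J = {..<r} - {c u}"
  have "(if c u = 0 then 1 else 0) \<in> J" using r2 by (auto simp: J_def)
  then have "J \<noteq> {}" "finite J" by (auto simp: J_def)
  then have "Min (?d ` J) \<in> ?d ` J" by (intro Min_in) auto
  then obtain j where j: "j \<in> J" "?d j = Min (?d ` J)" by auto
  have jmin: "?d j \<le> ?d i" if "i \<in> J" for i using that j \<open>finite J\<close> by simp
  have "u \<noteq> v" using assms irr by (auto simp: inner_def irreflp_def)
  have "2 * (?d j)\<^sup>2 \<le> pair_count miss V V"
  proof (rule missing_pairs_of_clique_extension[of "{u, v}" J])
    show "pairwise adj {u, v}" using assms sym by (auto simp: inner_def pairwise_insert dest: sympD)
    show "card {u, v} + card J = Suc r" using \<open>u \<noteq> v\<close> col[OF assms(1)] r2 by (simp add: J_def)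
    show "?d j \<le> card {w \<in> cls i. w \<in> V \<and> (\<forall>x\<in>{u, v}. adj x w)}" if "i \<in> J" for i
    proof -
      have "{w \<in> cls i. w \<in> V \<and> (\<forall>x\<in>{u, v}. adj x w)} = {w \<in> cls i. adj u w \<and> adj v w}"
        by (auto simp: cls_def)
      then show ?thesis using jmin[OF that] by simp
    qed
  qed (use assms in \<open>auto simp: J_def\<close>)
  moreover have "j < r" "j \<noteq> c u" using j(1) by (auto simp: J_def)
  ultimately show ?thesis by blast
qed

text \<open>Deleting \<open>B\<close> makes the missing pairs found here disjoint from those
  incident to \<open>B\<close>. It costs at most \<open>card B\<close> neighbours in each class,
  whence the truncated difference.\<close>

lemma missing_pairs_in_neighbourhood:
  assumes v: "v \<in> V" and B: "B \<subseteq> V"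
    and X: "\<And>j. j < r \<Longrightarrow> X \<le> card {w \<in> cls j. adj v w}"
  shows "2 * (X - card B)\<^sup>2 \<le> pair_count miss (V - B) (V - B)"
proof (rule missing_pairs_of_clique_extension[of "{v}" "{..<r}"])
  fix j assume "j \<in> {..<r}"
  then have "X \<le> card {w \<in> cls j. adj v w}" using X by simp
  moreover have "card {w \<in> cls j. adj v w} - card B \<le> card ({w \<in> cls j. adj v w} - B)"
    using finite_subset[OF B fin] by (rule diff_card_le_card_Diff)
  moreover have "{w \<in> cls j. adj v w} - B = {w \<in> cls j. w \<in> V - B \<and> (\<forall>u\<in>{v}. adj u w)}"
    by (auto simp: cls_def)
  ultimately show "X - card B \<le> card {w \<in> cls j. w \<in> V - B \<and> (\<forall>u\<in>{v}. adj u w)}" by simp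
qed (use v in auto)

text \<open>The few vertices \<open>B\<close> with many missing pairs meet every inner edge.  The inner edges not
  contained in \<open>B\<close> are counted from the vertices \<open>B'\<close> having an inner neighbour outside \<open>B\<close>; such a
  vertex misses almost an entire colour class, and the neighbourhood of one of largest inner
  degree \<open>X\<close> forces about \<open>X\<^sup>2\<close> further missing pairs.\<close>

lemma inner_and_missing_bounds:
  fixes \<eta> \<theta> :: real
  defines "n \<equiv> real (card V)"
  assumes pos: "n > 0" "\<eta> \<ge> 0" "\<theta> \<ge> 0" and small: "4 * \<eta> + 2 * \<theta> < 1 / r"
    and opt: "\<And>v j. v \<in> V \<Longrightarrow> j < r \<Longrightarrow>
      card {w \<in> V. adj v w \<and> c w = c v} \<le> card {w \<in> V. adj v w \<and> c w = j}"
    and miss_le: "pair_count miss V V \<le> 4 * \<eta>\<^sup>2 * n\<^sup>2"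
    and cls_ge: "\<And>j. j < r \<Longrightarrow> card (cls j) \<ge> n / r - 2 * \<eta> * n"
  shows "\<exists>b X k :: nat. b \<le> k \<and> \<theta> * n * k \<le> pair_count miss V V \<and>
    real (pair_count inner V V) \<le> 2 * real b * X + (real k)\<^sup>2 \<and>
    2 * (real (X - b))\<^sup>2 + 2 * b * (n / r - 4 * \<eta> * n - \<theta> * n)
      \<le> real (pair_count miss V V) + (real b)\<^sup>2"
proof -
  define mis where "mis v j = {w \<in> cls j. \<not> adj v w}" for v j
  define B where "B = {v \<in> V. \<exists>j<r. j \<noteq> c v \<and> \<theta> * n < card (mis v j)}"
  define B' where "B' = {v \<in> B. \<exists>u\<in>V - B. inner v u}"
  define din where "din v = card {w \<in> V. adj v w \<and> c w = c v}" for v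
  have BV: "B \<subseteq> V" "B' \<subseteq> B" by (auto simp: B_def B'_def)
  have finB: "finite B" "finite B'" using finite_subset[OF BV(1) fin] finite_subset[OF BV(2)] by auto
  have mis_le: "card (mis v j) \<le> card {w \<in> V. miss v w}" if "j \<noteq> c v" for v j
    using fin that by (intro card_mono) (auto simp: mis_def cls_def miss_def)
  have notB: "real (card (mis v j)) \<le> \<theta> * n" if "v \<in> V" "v \<notin> B" "j < r" "j \<noteq> c v" for v j
    using that unfolding B_def by (metis (mono_tags, lifting) mem_Collect_eq not_le)
  \<comment> \<open>Class \<open>j\<close> has at least \<open>n / r - 2 * \<eta> * n\<close>
    vertices, of which at most \<open>2 * \<eta> * n\<close> are common neighbours; each of the
    others is missed by \<open>u\<close> or by \<open>v\<close>.\<close>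
  have key: "\<exists>j<r. j \<noteq> c u \<and> n / r - 4 * \<eta> * n \<le> real (card (mis u j)) + card (mis v j)"
    if uv: "u \<in> V" "v \<in> V" "inner u v" for u v
  proof -
    obtain j where j: "j < r" "j \<noteq> c u"
      and q: "2 * (card {w \<in> cls j. adj u w \<and> adj v w})\<^sup>2 \<le> pair_count miss V V"
      using inner_edge_few_common_nbrs[OF uv] by blast
    define q where "q = card {w \<in> cls j. adj u w \<and> adj v w}"
    have "2 * (real q)\<^sup>2 \<le> real (pair_count miss V V)"
      using q unfolding q_def[symmetric] by (metis of_nat_le_iff of_nat_mult of_nat_numeral of_nat_power)
    then have "2 * (real q)\<^sup>2 \<le> (2 * \<eta> * n)\<^sup>2" using miss_le by (simp add: power_mult_distrib)
    then have "(real q)\<^sup>2 \<le> (2 * \<eta> * n)\<^sup>2" using zero_le_power2[of "real q"] by linarith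
    then have qle: "real q \<le> 2 * \<eta> * n" by (rule power2_le_imp_le) (use pos in auto)
    have "cls j \<subseteq> {w \<in> cls j. adj u w \<and> adj v w} \<union> (mis u j \<union> mis v j)" by (auto simp: mis_def)
    then have "card (cls j) \<le> card ({w \<in> cls j. adj u w \<and> adj v w} \<union> (mis u j \<union> mis v j))"
      using finite_cls[of j] by (intro card_mono) (auto simp: mis_def)
    also have "\<dots> \<le> q + (card (mis u j) + card (mis v j))"
      unfolding q_def by (meson add_left_mono card_Un_le order_trans)
    finally have "real (card (cls j)) \<le> real q + real (card (mis u j)) + real (card (mis v j))" by simp
    then show ?thesis using cls_ge[OF j(1)] qle j by (intro exI[of _ j]) auto
  qed
  have touch: "u \<in> B \<or> v \<in> B" if uv: "u \<in> V" "v \<in> V" "inner u v" for u v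
  proof (rule ccontr)
    assume uvB: "\<not> (u \<in> B \<or> v \<in> B)"
    obtain j where j: "j < r" "j \<noteq> c u"
      "n / r - 4 * \<eta> * n \<le> real (card (mis u j)) + card (mis v j)" using key[OF uv] by blast
    have "j \<noteq> c v" using j uv by (auto simp: inner_def)
    then have "real (card (mis u j)) \<le> \<theta> * n" "real (card (mis v j)) \<le> \<theta> * n"
      using uv uvB j notB by auto
    then have "n / r - 4 * \<eta> * n \<le> 2 * \<theta> * n" using j by simp
    then have "n * (1 / r) \<le> n * (4 * \<eta> + 2 * \<theta>)" by (simp add: algebra_simps)
    then show False using mult_strict_left_mono[OF small pos(1)] by linarith
  qed
  have B'miss: "n / r - 4 * \<eta> * n - \<theta> * n \<le> card {w \<in> V. miss v w}" if v: "v \<in> B'" for v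
  proof -
    obtain u where u: "u \<in> V" "u \<notin> B" "inner v u" using v by (auto simp: B'_def)
    have vV: "v \<in> V" using v BV by auto
    obtain j where j: "j < r" "j \<noteq> c v"
      "n / r - 4 * \<eta> * n \<le> real (card (mis v j)) + card (mis u j)" using key[OF vV u(1,3)] by blast
    have "j \<noteq> c u" using j u by (auto simp: inner_def)
    then have "real (card (mis u j)) \<le> \<theta> * n" using u j notB by auto
    then show ?thesis using j mis_le[OF j(2)] by linarith
  qed
  have b: "card B' \<le> card B" using BV finB by (intro card_mono) auto
  have VB': "V = B' \<union> (V - B')" "B' \<inter> (V - B') = {}" "finite (V - B')" using BV fin by auto
  have right: "pair_count R B' V = pair_count R B' B' + pair_count R B' (V - B')" for R :: "'a \<Rightarrow> 'a \<Rightarrow> bool"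
    using pair_count_Un_right[OF finB(2) VB'(3,2), of R B'] unfolding VB'(1)[symmetric] .
  have square: "pair_count R V V = pair_count R B' B' + 2 * pair_count R B' (V - B')
      + pair_count R (V - B') (V - B')" if "symp R" for R
    using pair_count_Un_square[OF finB(2) VB'(3,2) that] unfolding VB'(1)[symmetric] .
  have k: "\<theta> * n * card B \<le> pair_count miss V V"
  proof -
    have "\<theta> * n * card B = (\<Sum>v\<in>B. \<theta> * n)" by simp
    also have "\<dots> \<le> (\<Sum>v\<in>B. real (card {w \<in> V. miss v w}))"
    proof (rule sum_mono)
      fix v assume "v \<in> B"
      then obtain j where "j \<noteq> c v" "\<theta> * n < card (mis v j)" by (auto simp: B_def)
      then show "\<theta> * n \<le> real (card {w \<in> V. miss v w})" using mis_le[of j v] by linarith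
    qed
    also have "\<dots> \<le> (\<Sum>v\<in>V. real (card {w \<in> V. miss v w}))"
      using BV fin by (intro sum_mono2) auto
    finally show ?thesis by (simp add: pair_count_def)
  qed
  \<comment> \<open>\<open>X\<close> is the largest inner degree in \<open>B'\<close>, or 0 if
    \<open>B'\<close> is empty. By \<open>opt\<close> a vertex attaining it has at least
    \<open>X\<close> neighbours in every class.\<close>
  obtain X where X: "\<And>v. v \<in> B' \<Longrightarrow> din v \<le> X"
    and X2: "2 * (X - card B')\<^sup>2 \<le> pair_count miss (V - B') (V - B')"
  proof (cases "B' = {}")
    case True
    then show ?thesis using that[of 0] by simp
  next
    case False
    then have "Max (din ` B') \<in> din ` B'" using finB by (intro Max_in) auto
    then obtain v where v: "v \<in> B'" "din v = Max (din ` B')" by auto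
    have vV: "v \<in> V" using v BV by auto
    have "2 * (din v - card B')\<^sup>2 \<le> pair_count miss (V - B') (V - B')"
    proof (rule missing_pairs_in_neighbourhood[OF vV])
      fix j assume "j < r"
      moreover have "{w \<in> cls j. adj v w} = {w \<in> V. adj v w \<and> c w = j}" by (auto simp: cls_def)
      ultimately show "din v \<le> card {w \<in> cls j. adj v w}" using opt[OF vV] by (simp add: din_def)
    qed (use BV in auto)
    moreover have "din w \<le> din v" if "w \<in> B'" for w using that v finB by simp
    ultimately show ?thesis using that by blast
  qed
  have inner_le: "pair_count inner V V \<le> 2 * card B' * X + (card B)\<^sup>2"
  proof -
    have "pair_count inner B' V \<le> (\<Sum>v\<in>B'. X)"
      unfolding pair_count_def
    proof (rule sum_mono)
      fix v assume "v \<in> B'"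
      moreover have "{w \<in> V. inner v w} = {w \<in> V. adj v w \<and> c w = c v}" by (auto simp: inner_def)
      ultimately show "card {w \<in> V. inner v w} \<le> X" using X by (simp add: din_def)
    qed
    then have 1: "pair_count inner B' B' + pair_count inner B' (V - B') \<le> card B' * X"
      by (simp add: right)
    \<comment> \<open>By \<open>touch\<close> one end of such a pair is in \<open>B\<close>. Not
      being in \<open>B'\<close>, it has no inner neighbour outside \<open>B\<close>, so the other
      end is in \<open>B\<close> as well.\<close>
    have "pair_count inner (V - B') (V - B') \<le> card (B \<times> B)"
      unfolding pair_count_eq_card[OF VB'(3,3)]
    proof (rule card_mono)
      show "{(u, v). u \<in> V - B' \<and> v \<in> V - B' \<and> inner u v} \<subseteq> B \<times> B"
      proof clarify
        fix u v assume uv: "u \<in> V" "v \<in> V" "inner u v" "u \<notin> B'" "v \<notin> B'"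
        have "inner v u" using uv symp_inner by (auto dest: sympD)
        then show "u \<in> B \<and> v \<in> B" using uv touch[OF uv(1-3)] by (auto simp: B'_def)
      qed
    qed (use finB in auto)
    then have 2: "pair_count inner (V - B') (V - B') \<le> (card B)\<^sup>2"
      by (simp add: card_cartesian_product power2_eq_square)
    show ?thesis
      using square[OF symp_inner] 1 2 by simp
  qed
  \<comment> \<open>Doubling the missing pairs from \<open>B'\<close> to \<open>V\<close> counts
    those within \<open>B'\<close> once too often; \<open>(card B')\<^sup>2\<close>
    compensates.\<close>
  have miss_ge: "2 * (X - card B')\<^sup>2 + 2 * pair_count miss B' V \<le> pair_count miss V V + (card B')\<^sup>2"
  proof -
    have "pair_count miss B' B' \<le> (card B')\<^sup>2"
      using pair_count_le[OF finB(2)] by (simp add: power2_eq_square)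
    moreover have "pair_count miss B' V = pair_count miss B' B' + pair_count miss B' (V - B')"
      by (simp add: right)
    ultimately show ?thesis
      using square[OF symp_miss] X2 by simp
  qed
  have "card B' * (n / r - 4 * \<eta> * n - \<theta> * n) = (\<Sum>v\<in>B'. n / r - 4 * \<eta> * n - \<theta> * n)" by simp
  also have "\<dots> \<le> (\<Sum>v\<in>B'. real (card {w \<in> V. miss v w}))" by (intro sum_mono B'miss)
  also have "\<dots> = pair_count miss B' V" by (simp add: pair_count_def)
  finally have 3: "card B' * (n / r - 4 * \<eta> * n - \<theta> * n) \<le> pair_count miss B' V" .
  have 4: "2 * (real (X - card B'))\<^sup>2 + 2 * pair_count miss B' V \<le> pair_count miss V V + (real (card B'))\<^sup>2"
    using miss_ge by (simp only: of_nat_le_iff[symmetric, where ?'a = real] of_nat_add of_nat_mult of_nat_power of_nat_numeral)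
  have 5: "real (pair_count inner V V) \<le> 2 * real (card B') * X + (real (card B))\<^sup>2"
    using inner_le by (simp only: of_nat_le_iff[symmetric, where ?'a = real] of_nat_add of_nat_mult of_nat_power of_nat_numeral)
  show ?thesis
  proof (rule exI[of _ "card B'"], rule exI[of _ X], rule exI[of _ "card B"], intro conjI)
    show "2 * (real (X - card B'))\<^sup>2 + 2 * real (card B') * (n / r - 4 * \<eta> * n - \<theta> * n)
        \<le> real (pair_count miss V V) + (real (card B'))\<^sup>2"
      using 3 4 by (simp only: mult.assoc)
  qed (use b k 5 in auto)
qed

lemma pair_count_adj_add_miss:
  "pair_count adj V V + pair_count miss V V
    = pair_count (\<lambda>u v. c u \<noteq> c v) V V + pair_count inner V V"
proof -
  have "pair_count (\<lambda>u v. adj u v \<or> miss u v) V V = pair_count (\<lambda>u v. c u \<noteq> c v \<or> inner u v) V V"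
    by (intro pair_count_cong) (auto simp: miss_def inner_def)
  then show ?thesis
    using pair_count_disj[OF fin fin, of adj miss]
      pair_count_disj[OF fin fin, of "\<lambda>u v. c u \<noteq> c v" inner] by (simp add: miss_def inner_def)
qed

lemma sum_card_cls: "(\<Sum>j<r. card (cls j)) = card V"
  using sum.group[OF fin, of "{..<r}" c "\<lambda>_. 1 :: nat"] col by (auto simp: cls_def)

lemma pair_count_cross:
  "pair_count (\<lambda>u v. c u \<noteq> c v) V V + (\<Sum>j<r. (card (cls j))\<^sup>2) = (card V)\<^sup>2"
proof -
  have "(\<Sum>j<r. \<Sum>u\<in>{u \<in> V. c u = j}. card (cls (c u))) = (\<Sum>u\<in>V. card (cls (c u)))"
    using fin col by (intro sum.group) auto
  moreover have "(\<Sum>u\<in>{u \<in> V. c u = j}. card (cls (c u))) = (card (cls j))\<^sup>2" for j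
    by (simp add: cls_def power2_eq_square)
  moreover have "(\<Sum>u\<in>V. card (cls (c u))) = pair_count (\<lambda>u v. c u = c v) V V"
    by (auto simp: pair_count_def cls_def intro!: sum.cong arg_cong[where f = card])
  ultimately have "(\<Sum>j<r. (card (cls j))\<^sup>2) = pair_count (\<lambda>u v. c u = c v) V V" by simp
  moreover have "pair_count (\<lambda>u v. c u \<noteq> c v \<or> c u = c v) V V = (card V)\<^sup>2"
    by (simp add: pair_count_def power2_eq_square)
  ultimately show ?thesis
    using pair_count_disj[OF fin fin, of "\<lambda>u v. c u \<noteq> c v" "\<lambda>u v. c u = c v"] by simp
qed

text \<open>Edges plus missing pairs equal cross pairs plus inner pairs, and the cross pairs fall
  short of \<open>(1 - 1 / r) * n\<^sup>2\<close> by the sum of the squared deviations of the class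
  sizes from \<open>n / r\<close>. Discarding the deviations bounds the missing pairs; discarding
  the missing pairs bounds each deviation.\<close>

lemma balanced_of_many_edges:
  fixes \<eta> :: real
  defines "n \<equiv> real (card V)"
  assumes "\<eta> \<ge> 0"
    and edges: "real (pair_count adj V V) \<ge> (1 - 1 / r) * n\<^sup>2 - 2 * \<eta>\<^sup>2 * n\<^sup>2"
    and inner_le: "real (pair_count inner V V) \<le> 2 * \<eta>\<^sup>2 * n\<^sup>2"
  shows "real (pair_count miss V V) \<le> pair_count inner V V + 2 * \<eta>\<^sup>2 * n\<^sup>2"
    and "j < r \<Longrightarrow> real (card (cls j)) \<ge> n / r - 2 * \<eta> * n"
proof -
  define S where "S = (\<Sum>j<r. (real (card (cls j)))\<^sup>2)"
  define cross where "cross = real (pair_count (\<lambda>u v. c u \<noteq> c v) V V)"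
  have r: "real r > 0" using r2 by simp
  have n: "(\<Sum>j<r. real (card (cls j))) = n" unfolding n_def sum_card_cls[symmetric] by simp
  have dev: "(\<Sum>j<r. (real (card (cls j)) - n / r)\<^sup>2) = S - n\<^sup>2 / r"
  proof -
    have "(\<Sum>j<r. (real (card (cls j)) - n / r)\<^sup>2)
        = S + (\<Sum>j<r. (n / r)\<^sup>2) - (\<Sum>j<r. 2 * real (card (cls j)) * (n / r))"
      by (simp add: power2_diff sum.distrib sum_subtractf S_def)
    also have "(\<Sum>j<r. 2 * real (card (cls j)) * (n / r)) = 2 * n * (n / r)"
      unfolding n[symmetric] sum_distrib_left[symmetric] sum_distrib_right[symmetric] ..
    finally have "(\<Sum>j<r. (real (card (cls j)) - n / r)\<^sup>2) = S + (\<Sum>j<r. (n / r)\<^sup>2) - 2 * n * (n / r)" .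
    moreover have "(\<Sum>j<r. (n / r)\<^sup>2) = n\<^sup>2 / r" "2 * n * (n / r) = 2 * (n\<^sup>2 / r)"
      using r by (simp_all add: power2_eq_square)
    ultimately show ?thesis by linarith
  qed
  have cross: "cross + S = n\<^sup>2"
    using arg_cong[OF pair_count_cross, of real] by (simp add: cross_def S_def n_def)
  have tot: "real (pair_count adj V V) + pair_count miss V V = cross + pair_count inner V V"
    using arg_cong[OF pair_count_adj_add_miss, of real] by (simp add: cross_def)
  have "S \<ge> n\<^sup>2 / r" using dev sum_nonneg[of "{..<r}" "\<lambda>j. (real (card (cls j)) - n / r)\<^sup>2"] by simp
  then show "real (pair_count miss V V) \<le> pair_count inner V V + 2 * \<eta>\<^sup>2 * n\<^sup>2"
    using edges tot cross by (simp add: algebra_simps)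
  assume j: "j < r"
  have "(real (card (cls j)) - n / r)\<^sup>2 \<le> S - n\<^sup>2 / r"
    unfolding dev[symmetric] using j by (intro member_le_sum) auto
  also have "\<dots> \<le> (2 * \<eta> * n)\<^sup>2"
    using edges tot cross inner_le by (simp add: algebra_simps power_mult_distrib)
  finally have "\<bar>real (card (cls j)) - n / r\<bar> \<le> 2 * \<eta> * n"
    using assms(2) by (simp add: abs_le_square_iff[symmetric] n_def)
  then show "real (card (cls j)) \<ge> n / r - 2 * \<eta> * n" by linarith
qed

end

section \<open>The extremal problem for the densities\<close>

lemma cubic_le:
  fixes x t :: real
  assumes "0 \<le> x" "0 \<le> t"
  shows "x * (3 * t\<^sup>2 - x\<^sup>2) \<le> 2 * t ^ 3"
proof -
  have "0 \<le> (x - t)\<^sup>2 * (x + 2 * t)" using assms by simp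
  then show ?thesis by (simp add: power2_eq_square power3_eq_cube algebra_simps)
qed

text \<open>Here \<open>b\<close>, \<open>x\<close>, \<open>k\<close>, \<open>y\<close> are the cardinalities from the bounds above divided by \<open>n\<close>, and
  \<open>\<mu>\<close>, \<open>\<iota>\<close> the numbers of missing and inner pairs divided by \<open>n\<^sup>2\<close>.  To leading order the constraint
  reads \<open>x\<^sup>2 + b / r \<le> \<eta>\<^sup>2\<close>, under which \<open>b * x\<close> is largest at \<open>x = \<eta> / sqrt 3\<close>.\<close>

lemma inner_density_bound:
  fixes r \<eta> \<theta> b x k y \<mu> \<iota> :: real
  defines "K \<equiv> 4 / \<theta>"
  defines "L \<equiv> 3 * K * (2 + 2 * K) + K\<^sup>2"
  assumes "0 < r" "0 < \<eta>" "\<eta> \<le> 1" "0 < \<theta>" "0 \<le> b" "0 \<le> x" "0 \<le> k" "0 \<le> y"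
    and small: "r * (4 * \<eta> + \<theta>) < 1"
    and b: "b \<le> k" and k: "\<theta> * k \<le> \<mu>" and y: "x - b \<le> y"
    and \<iota>: "\<iota> \<le> 2 * b * x + k\<^sup>2" and \<mu>: "\<mu> \<le> \<iota> + 2 * \<eta>\<^sup>2" "\<mu> \<le> 4 * \<eta>\<^sup>2"
    and main: "2 * y\<^sup>2 + 2 * b * (1 / r - 4 * \<eta> - \<theta>) \<le> \<mu> + b\<^sup>2"
  shows "\<iota> / 2 \<le> \<eta> ^ 3 * (2 * r / (1 - r * (4 * \<eta> + \<theta>)) * (sqrt ((1 + L * \<eta>) / 3)) ^ 3 + K\<^sup>2 * \<eta> / 2)"
proof -
  define q where "q = 1 - r * (4 * \<eta> + \<theta>)"
  define G where "G = 2 + 2 * K"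
  have q: "q > 0" using small by (simp add: q_def)
  have K: "K > 0" using assms by (simp add: K_def)
  have L: "L \<ge> 0" using K by (simp add: L_def)
  have qr: "1 / r - 4 * \<eta> - \<theta> = q / r" using \<open>0 < r\<close> by (simp add: q_def field_simps)
  have "\<theta> * k \<le> 4 * \<eta>\<^sup>2" using k \<mu> by simp
  \<comment> \<open>The value of \<open>K\<close> is chosen for this bound: there are at most
    \<open>4 * \<eta>\<^sup>2\<close> missing pairs, and each exceptional vertex accounts for
    \<open>\<theta>\<close>.\<close>
  then have kK: "k \<le> K * \<eta>\<^sup>2" using \<open>0 < \<theta>\<close> by (simp add: K_def field_simps)
  have \<eta>2: "\<eta>\<^sup>2 \<le> \<eta>" using assms by (simp add: power2_eq_square mult_left_le)
  have \<eta>4: "\<eta> ^ 4 \<le> \<eta> ^ 3" "\<eta> ^ 3 \<le> \<eta>\<^sup>2" using assms by (intro power_decreasing; simp)+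
  have kK1: "k \<le> K * \<eta>" using kK mult_left_mono[OF \<eta>2, of K] K by linarith
  have k2: "k\<^sup>2 \<le> K\<^sup>2 * \<eta> ^ 4"
    using power_mono[OF kK, of 2] \<open>0 \<le> k\<close> by (simp add: power_mult_distrib flip: power_mult)
  have b2: "b\<^sup>2 \<le> k\<^sup>2" using b assms by (intro power_mono) auto
  have "0 \<le> 2 * b * (1 / r - 4 * \<eta> - \<theta>)" unfolding qr using assms q by simp
  \<comment> \<open>A crude first estimate gives \<open>x\<close> of order \<open>\<eta>\<close>,
    hence \<open>b * x\<close> of order \<open>\<eta> ^ 3\<close>. This makes the error terms below
    negligible.\<close>
  then have "2 * y\<^sup>2 \<le> 4 * \<eta>\<^sup>2 + K\<^sup>2 * \<eta> ^ 4" using main \<mu> k2 b2 by linarith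
  also have "\<dots> \<le> 4 * \<eta>\<^sup>2 + K\<^sup>2 * \<eta>\<^sup>2"
    using \<eta>4 by (intro add_left_mono mult_left_mono) auto
  also have "\<dots> \<le> ((2 + K) * \<eta>)\<^sup>2"
    using K \<open>0 < \<eta>\<close> by (simp add: power2_eq_square algebra_simps)
  finally have "y\<^sup>2 \<le> ((2 + K) * \<eta>)\<^sup>2" using zero_le_power2[of y] by linarith
  then have "y \<le> (2 + K) * \<eta>" by (rule power2_le_imp_le) (use K assms in auto)
  then have xG: "x \<le> G * \<eta>" using y b kK1 by (simp add: G_def algebra_simps)
  have bx: "b * x \<le> K * G * \<eta> ^ 3"
  proof -
    have "b * x \<le> (K * \<eta>\<^sup>2) * (G * \<eta>)" using b kK xG assms K by (intro mult_mono) auto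
    then show ?thesis by (simp add: power2_eq_square power3_eq_cube mult_ac)
  qed
  \<comment> \<open>Only \<open>y \<ge> 0\<close> and \<open>y \<ge> x - b\<close> are known, since
    \<open>y\<close> stands for a truncated difference; for \<open>x < b\<close> the left side is
    not positive.\<close>
  have yx: "x\<^sup>2 - 2 * b * x \<le> y\<^sup>2"
  proof (cases "b \<le> x")
    case True
    then have "(x - b)\<^sup>2 \<le> y\<^sup>2" using y by (intro power_mono) auto
    moreover have "x\<^sup>2 - 2 * b * x \<le> (x - b)\<^sup>2" by (simp add: power2_diff mult_ac)
    ultimately show ?thesis by linarith
  next
    case False
    then have "x * (x - 2 * b) \<le> 0" using assms by (intro mult_nonneg_nonpos) auto
    then have "x\<^sup>2 - 2 * b * x \<le> 0" by (simp add: power2_eq_square algebra_simps)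
    then show ?thesis using zero_le_power2[of y] by linarith
  qed
  define P where "P = \<eta>\<^sup>2 * (1 + L * \<eta>)"
  \<comment> \<open>The bound on \<open>\<mu>\<close> through \<open>\<iota>\<close> replaces
    \<open>4 * \<eta>\<^sup>2\<close> by \<open>2 * \<eta>\<^sup>2\<close> plus lower order terms,
    which gives the sharp constant. The coefficient 6 is 4 from \<open>yx\<close> plus 2 from
    \<open>\<iota>\<close>.\<close>
  have "2 * x\<^sup>2 + 2 * (b * (q / r)) \<le> 2 * \<eta>\<^sup>2 + 6 * (b * x) + 2 * k\<^sup>2"
    using main[unfolded qr] yx \<mu> \<iota> b2 by linarith
  then have "x\<^sup>2 + b * (q / r) \<le> \<eta>\<^sup>2 + 3 * (b * x) + k\<^sup>2" by simp
  also have "\<dots> \<le> \<eta>\<^sup>2 + 3 * (K * G * \<eta> ^ 3) + K\<^sup>2 * \<eta> ^ 3"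
    using bx k2 mult_left_mono[OF \<eta>4(1), of "K\<^sup>2"] by simp
  also have "\<dots> = P" by (simp add: P_def L_def G_def power2_eq_square power3_eq_cube algebra_simps)
  finally have "b * (q / r) \<le> P - x\<^sup>2" by simp
  then have "b \<le> r / q * (P - x\<^sup>2)" using q \<open>0 < r\<close> by (simp add: field_simps)
  then have "b * x \<le> r / q * (P - x\<^sup>2) * x" using assms by (intro mult_right_mono)
  \<comment> \<open>\<open>P\<close> is written as three times a square so that
    \<open>cubic_le\<close> applies.\<close>
  also have "\<dots> = r / q * (x * (3 * (\<eta> * sqrt ((1 + L * \<eta>) / 3))\<^sup>2 - x\<^sup>2))"
    using L \<open>0 < \<eta>\<close> by (simp add: P_def power_mult_distrib)
  also have "\<dots> \<le> r / q * (2 * (\<eta> * sqrt ((1 + L * \<eta>) / 3)) ^ 3)"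
    using q assms L by (intro mult_left_mono cubic_le) auto
  also have "\<dots> = \<eta> ^ 3 * (2 * r / q * (sqrt ((1 + L * \<eta>) / 3)) ^ 3)"
    by (simp add: power_mult_distrib)
  finally have "b * x \<le> \<eta> ^ 3 * (2 * r / q * (sqrt ((1 + L * \<eta>) / 3)) ^ 3)" .
  moreover have "k\<^sup>2 / 2 \<le> \<eta> ^ 3 * (K\<^sup>2 * \<eta> / 2)"
    using k2 by (simp add: power_numeral_reduce algebra_simps)
  ultimately show ?thesis using \<iota> unfolding q_def[symmetric] distrib_left[of "\<eta> ^ 3"] by linarith
qed

text \<open>The order of choice matters: \<open>\<theta>\<close> is fixed first, small enough for
  the limit at \<open>\<eta> = 0\<close> to be below the target, and only then \<open>\<eta>\<close>
  is made small, as \<open>K\<close> and \<open>L\<close> blow up when \<open>\<theta>\<close> tends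
  to 0.\<close>

lemma inner_density_bound_asymp:
  fixes r \<epsilon> :: real
  assumes "0 < r" "0 < \<epsilon>"
  obtains \<theta> d where "0 < \<theta>" "0 < d"
    "\<And>\<eta> K L. 0 < \<eta> \<Longrightarrow> \<eta> < d \<Longrightarrow> K = 4 / \<theta> \<Longrightarrow> L = 3 * K * (2 + 2 * K) + K\<^sup>2 \<Longrightarrow>
      \<eta> \<le> 1 \<and> 4 * \<eta> + 2 * \<theta> < 1 / r \<and>
      2 * r / (1 - r * (4 * \<eta> + \<theta>)) * (sqrt ((1 + L * \<eta>) / 3)) ^ 3 + K\<^sup>2 * \<eta> / 2
        < 2 * r / (3 * sqrt 3) + \<epsilon>"
proof -
  have s3: "(sqrt (1 / 3)) ^ 3 = 1 / (3 * sqrt 3)"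
    by (simp add: real_sqrt_divide power_divide power3_eq_cube)
  have "((\<lambda>\<theta>. 2 * r / (1 - r * \<theta>) * (sqrt (1 / 3)) ^ 3)
      \<longlongrightarrow> 2 * r / (1 - r * 0) * (sqrt (1 / 3)) ^ 3) (at_right 0)"
    by (intro tendsto_intros) auto
  then have "\<forall>\<^sub>F \<theta> in at_right 0. 2 * r / (1 - r * \<theta>) * (sqrt (1 / 3)) ^ 3 < 2 * r / (3 * sqrt 3) + \<epsilon>"
    by (rule order_tendstoD) (use assms in \<open>simp add: s3\<close>)
  moreover have "\<forall>\<^sub>F \<theta> in at_right 0. 0 < \<theta> \<and> \<theta> < 1 / (2 * r)"
    using assms by (intro eventually_conj eventually_at_right_less eventually_at_right_real[THEN eventually_mono]) auto
  ultimately have "\<forall>\<^sub>F \<theta> in at_right 0. 0 < \<theta> \<and> \<theta> < 1 / (2 * r) \<and>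
      2 * r / (1 - r * \<theta>) * (sqrt (1 / 3)) ^ 3 < 2 * r / (3 * sqrt 3) + \<epsilon>"
    by eventually_elim auto
  from eventually_happens'[OF _ this] obtain \<theta> where \<theta>: "0 < \<theta>" "\<theta> < 1 / (2 * r)"
      "2 * r / (1 - r * \<theta>) * (sqrt (1 / 3)) ^ 3 < 2 * r / (3 * sqrt 3) + \<epsilon>" by auto
  define K where "K = 4 / \<theta>"
  define L where "L = 3 * K * (2 + 2 * K) + K\<^sup>2"
  have r\<theta>: "r * \<theta> < 1" "2 * \<theta> < 1 / r" using \<theta> assms by (simp_all add: field_simps)
  have "((\<lambda>\<eta>. 2 * r / (1 - r * (4 * \<eta> + \<theta>)) * (sqrt ((1 + L * \<eta>) / 3)) ^ 3 + K\<^sup>2 * \<eta> / 2)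
      \<longlongrightarrow> 2 * r / (1 - r * (4 * 0 + \<theta>)) * (sqrt ((1 + L * 0) / 3)) ^ 3 + K\<^sup>2 * 0 / 2) (at_right 0)"
    using r\<theta> by (intro tendsto_intros) auto
  then have 1: "\<forall>\<^sub>F \<eta> in at_right 0. 2 * r / (1 - r * (4 * \<eta> + \<theta>)) * (sqrt ((1 + L * \<eta>) / 3)) ^ 3 + K\<^sup>2 * \<eta> / 2
      < 2 * r / (3 * sqrt 3) + \<epsilon>"
    by (rule order_tendstoD) (use \<theta> in simp)
  have "((\<lambda>\<eta>. 4 * \<eta> + 2 * \<theta>) \<longlongrightarrow> 4 * 0 + 2 * \<theta>) (at_right 0)" by (intro tendsto_intros)
  then have 2: "\<forall>\<^sub>F \<eta> in at_right 0. 4 * \<eta> + 2 * \<theta> < 1 / r"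
    by (rule order_tendstoD) (use r\<theta> in simp)
  have 3: "\<forall>\<^sub>F \<eta> in at_right (0 :: real). \<eta> \<le> 1"
    using eventually_at_right_real[of 0 1] by (auto elim: eventually_mono)
  have "\<forall>\<^sub>F \<eta> in at_right 0. \<eta> \<le> 1 \<and> 4 * \<eta> + 2 * \<theta> < 1 / r \<and>
      2 * r / (1 - r * (4 * \<eta> + \<theta>)) * (sqrt ((1 + L * \<eta>) / 3)) ^ 3 + K\<^sup>2 * \<eta> / 2
        < 2 * r / (3 * sqrt 3) + \<epsilon>"
    using 1 2 3 by eventually_elim auto
  then obtain d where "0 < d" "\<forall>\<eta>>0. \<eta> < d \<longrightarrow> \<eta> \<le> 1 \<and> 4 * \<eta> + 2 * \<theta> < 1 / r \<and>
      2 * r / (1 - r * (4 * \<eta> + \<theta>)) * (sqrt ((1 + L * \<eta>) / 3)) ^ 3 + K\<^sup>2 * \<eta> / 2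
        < 2 * r / (3 * sqrt 3) + \<epsilon>"
    unfolding eventually_at_right_field by auto
  then show ?thesis using that[of \<theta> d] \<theta> by (auto simp: K_def L_def)
qed

section \<open>The sharp colouring bound in terms of edges\<close>

text \<open>Fueredi's colouring \<open>c0\<close> serves only to bound the inner pairs by
  \<open>2 * \<eta>\<^sup>2 * n\<^sup>2\<close>; the locally optimal \<open>c\<close> inherits this
  bound and is the one analysed. Dividing all counts by powers of \<open>n\<close> leads to
  \<open>inner_density_bound\<close>.\<close>

lemma ex_colouring_few_inner_edges_sharp:
  fixes r :: nat and \<epsilon> :: real
  assumes r: "2 \<le> r" and \<epsilon>: "0 < \<epsilon>"
  shows "\<exists>d>0. \<forall>\<eta> (V :: 'a set) adj. 0 < \<eta> \<longrightarrow> \<eta> < d \<longrightarrow>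
    finite V \<longrightarrow> V \<noteq> {} \<longrightarrow> symp adj \<longrightarrow> irreflp adj \<longrightarrow>
    (\<forall>K\<subseteq>V. card K = Suc r \<longrightarrow> \<not> pairwise adj K) \<longrightarrow>
    real (pair_count adj V V) \<ge> (1 - 1 / r) * (real (card V))\<^sup>2 - 2 * \<eta>\<^sup>2 * (real (card V))\<^sup>2 \<longrightarrow>
    (\<exists>c :: 'a \<Rightarrow> nat. (\<forall>v\<in>V. c v < r) \<and>
      real (pair_count (\<lambda>u v. adj u v \<and> c u = c v) V V) / 2
        \<le> (2 * real r / (3 * sqrt 3) + \<epsilon>) * \<eta> ^ 3 * (real (card V))\<^sup>2)"
proof -
  have "0 < real r" using r by simp
  from inner_density_bound_asymp[OF this \<epsilon>] obtain \<theta> d where \<theta>: "0 < \<theta>" and d: "0 < d"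
    and asy: "\<And>\<eta> K L. 0 < \<eta> \<Longrightarrow> \<eta> < d \<Longrightarrow> K = 4 / \<theta> \<Longrightarrow> L = 3 * K * (2 + 2 * K) + K\<^sup>2 \<Longrightarrow>
      \<eta> \<le> 1 \<and> 4 * \<eta> + 2 * \<theta> < 1 / real r \<and>
      2 * real r / (1 - real r * (4 * \<eta> + \<theta>)) * (sqrt ((1 + L * \<eta>) / 3)) ^ 3 + K\<^sup>2 * \<eta> / 2
        < 2 * real r / (3 * sqrt 3) + \<epsilon>" by blast
  define K where "K = 4 / \<theta>"
  define L where "L = 3 * K * (2 + 2 * K) + K\<^sup>2"
  show ?thesis
  proof (intro exI[of _ d] conjI allI impI d)
    fix \<eta> :: real and V :: "'a set" and adj
    assume \<eta>: "0 < \<eta>" "\<eta> < d" and V: "finite V" "V \<noteq> {}" and adj: "symp adj" "irreflp adj"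
      and free: "\<forall>K\<subseteq>V. card K = Suc r \<longrightarrow> \<not> pairwise adj K"
      and edges: "real (pair_count adj V V)
        \<ge> (1 - 1 / r) * (real (card V))\<^sup>2 - 2 * \<eta>\<^sup>2 * (real (card V))\<^sup>2"
    define n where "n = real (card V)"
    have n: "n > 0" using V by (simp add: n_def card_gt_0_iff)
    have sm: "\<eta> \<le> 1" "4 * \<eta> + 2 * \<theta> < 1 / r"
      and \<Phi>: "2 * real r / (1 - real r * (4 * \<eta> + \<theta>)) * (sqrt ((1 + L * \<eta>) / 3)) ^ 3 + K\<^sup>2 * \<eta> / 2
        < 2 * real r / (3 * sqrt 3) + \<epsilon>"
      using asy[OF \<eta> K_def L_def] by auto
    obtain c0 :: "'a \<Rightarrow> nat" where c0: "\<forall>v\<in>V. c0 v < r"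
      "pair_count adj V V + pair_count (\<lambda>u v. adj u v \<and> c0 u = c0 v) V V
        \<le> pair_count (\<lambda>u v. c0 u \<noteq> c0 v) V V"
      using ex_colouring_few_inner_edges[OF adj V(1) free] by blast
    obtain c where c: "\<forall>v\<in>V. c v < r"
      "pair_count (\<lambda>u v. adj u v \<and> c u = c v) V V \<le> pair_count (\<lambda>u v. adj u v \<and> c0 u = c0 v) V V"
      and opt: "\<forall>v\<in>V. \<forall>j<r. card {w \<in> V. adj v w \<and> c w = c v} \<le> card {w \<in> V. adj v w \<and> c w = j}"
      using ex_locally_optimal_colouring[OF adj V(1) c0(1)] by blast
    interpret C0: clique_free_colouring V adj c0 r
      by unfold_locales (use V adj r free c0 in auto)
    interpret C: clique_free_colouring V adj c r
      by unfold_locales (use V adj r free c in auto)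
    \<comment> \<open>Turan's bound for \<open>r\<close> classes, by Cauchy--Schwarz for the class
      sizes.\<close>
    have cross0: "real (pair_count (\<lambda>u v. c0 u \<noteq> c0 v) V V) \<le> (1 - 1 / r) * n\<^sup>2"
    proof -
      define S where "S = (\<Sum>j<r. (real (card (C0.cls j)))\<^sup>2)"
      have "(\<Sum>j<r. real (card (C0.cls j)))\<^sup>2 \<le> real r * S"
        using sum_squared_le_sum_of_squares[of "\<lambda>j. real (card (C0.cls j))" "{..<r}"]
        by (simp add: mult.commute S_def)
      moreover have "(\<Sum>j<r. real (card (C0.cls j))) = n"
        unfolding n_def C0.sum_card_cls[symmetric] by simp
      ultimately have "n\<^sup>2 / r \<le> S" using r by (simp add: field_simps)
      moreover have "real (pair_count (\<lambda>u v. c0 u \<noteq> c0 v) V V) + S = n\<^sup>2"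
        using arg_cong[OF C0.pair_count_cross, of real] by (simp add: n_def S_def)
      ultimately show ?thesis by (simp add: left_diff_distrib)
    qed
    have innC: "pair_count C.inner V V = pair_count (\<lambda>u v. adj u v \<and> c u = c v) V V"
      by (simp add: C.inner_def[abs_def])
    have inner_le: "real (pair_count C.inner V V) \<le> 2 * \<eta>\<^sup>2 * n\<^sup>2"
    proof -
      have "pair_count adj V V + pair_count C.inner V V \<le> pair_count (\<lambda>u v. c0 u \<noteq> c0 v) V V"
        using c(2) c0(2) unfolding innC by linarith
      then have "real (pair_count adj V V) + real (pair_count C.inner V V) \<le> (1 - 1 / r) * n\<^sup>2"
        using cross0 by linarith
      then show ?thesis using edges unfolding n_def by linarith
    qed
    have \<eta>0: "\<eta> \<ge> 0" using \<eta> by simp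
    note bal = C.balanced_of_many_edges[OF \<eta>0 edges inner_le[unfolded n_def], folded n_def]
    have miss_le: "real (pair_count C.miss V V) \<le> 4 * \<eta>\<^sup>2 * n\<^sup>2" using bal(1) inner_le by linarith
    obtain b X k :: nat where bk: "b \<le> k" "\<theta> * n * k \<le> pair_count C.miss V V"
      "real (pair_count C.inner V V) \<le> 2 * real b * X + (real k)\<^sup>2"
      "2 * (real (X - b))\<^sup>2 + 2 * b * (n / r - 4 * \<eta> * n - \<theta> * n)
        \<le> real (pair_count C.miss V V) + (real b)\<^sup>2"
      using C.inner_and_missing_bounds[of \<eta> \<theta>, folded n_def] n \<eta> \<theta> sm opt miss_le bal(2) by auto
    define \<iota> where "\<iota> = real (pair_count C.inner V V) / n\<^sup>2"
    define \<mu> where "\<mu> = real (pair_count C.miss V V) / n\<^sup>2"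
    have I: "real (pair_count C.inner V V) = \<iota> * n\<^sup>2" and M: "real (pair_count C.miss V V) = \<mu> * n\<^sup>2"
      using n by (simp_all add: \<iota>_def \<mu>_def)
    have n2: "n\<^sup>2 > 0" using n by simp
    have "\<iota> / 2 \<le> \<eta> ^ 3 * (2 * real r / (1 - real r * (4 * \<eta> + \<theta>)) * (sqrt ((1 + L * \<eta>) / 3)) ^ 3 + K\<^sup>2 * \<eta> / 2)"
      unfolding L_def K_def
    proof (rule inner_density_bound[where b = "b / n" and x = "X / n" and k = "k / n"
          and y = "real (X - b) / n" and \<mu> = \<mu>])
      show "real r * (4 * \<eta> + \<theta>) < 1"
      proof -
        have "4 * \<eta> + \<theta> < 1 / r" using sm \<theta> by simp
        then show ?thesis using r by (simp add: field_simps)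
      qed
      show "\<theta> * (k / n) \<le> \<mu>" using bk(2) n by (simp add: \<mu>_def field_simps power2_eq_square)
      show "X / n - b / n \<le> real (X - b) / n" using n by (simp add: divide_right_mono flip: diff_divide_distrib)
      show "\<iota> \<le> 2 * (b / n) * (X / n) + (k / n)\<^sup>2"
        using bk(3) n by (simp add: \<iota>_def field_simps power2_eq_square)
      show "\<mu> \<le> \<iota> + 2 * \<eta>\<^sup>2" using bal(1) n2 unfolding I M by (simp flip: distrib_right)
      show "\<mu> \<le> 4 * \<eta>\<^sup>2" using miss_le n2 unfolding M by simp
      show "2 * (real (X - b) / n)\<^sup>2 + 2 * (b / n) * (1 / r - 4 * \<eta> - \<theta>) \<le> \<mu> + (b / n)\<^sup>2"
      proof -
        have "n\<^sup>2 * (2 * (real (X - b) / n)\<^sup>2 + 2 * (b / n) * (1 / r - 4 * \<eta> - \<theta>))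
            = 2 * (real (X - b))\<^sup>2 + 2 * b * (n / r - 4 * \<eta> * n - \<theta> * n)"
          using n r by (simp add: field_simps power2_eq_square)
        also have "\<dots> \<le> \<mu> * n\<^sup>2 + (real b)\<^sup>2" using bk(4) unfolding M .
        also have "\<dots> = n\<^sup>2 * (\<mu> + (b / n)\<^sup>2)" using n by (simp add: distrib_left power_divide)
        finally show ?thesis using n2 by simp
      qed
    qed (use r \<eta> sm \<theta> n bk in \<open>auto simp: divide_right_mono\<close>)
    also have "\<dots> \<le> \<eta> ^ 3 * (2 * real r / (3 * sqrt 3) + \<epsilon>)"
      using \<Phi> \<eta> by (intro mult_left_mono) auto
    finally have "\<iota> / 2 * n\<^sup>2 \<le> \<eta> ^ 3 * (2 * real r / (3 * sqrt 3) + \<epsilon>) * n\<^sup>2"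
      by (intro mult_right_mono) auto
    then have "real (pair_count C.inner V V) / 2 \<le> (2 * real r / (3 * sqrt 3) + \<epsilon>) * \<eta> ^ 3 * n\<^sup>2"
      unfolding I by (simp add: mult_ac)
    then show "\<exists>c :: 'a \<Rightarrow> nat. (\<forall>v\<in>V. c v < r) \<and>
      real (pair_count (\<lambda>u v. adj u v \<and> c u = c v) V V) / 2
        \<le> (2 * real r / (3 * sqrt 3) + \<epsilon>) * \<eta> ^ 3 * (real (card V))\<^sup>2"
      using c(1) unfolding innC n_def by blast
  qed
qed

section \<open>Transfer to edge sets and \<open>D_r\<close>\<close>

text \<open>The handshake lemma, as the degree sum over cliques of size one.\<close>

lemma pair_count_eq_card_cliques_2:
  assumes sym: "symp adj" and irr: "irreflp adj" and V: "finite V"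
  shows "pair_count adj V V = 2 * card (cliques adj V 2)"
proof -
  have C1: "cliques adj V (Suc 0) = (\<lambda>v. {v}) ` V"
    by (auto simp: cliques_def card_Suc_eq)
  have "real (pair_count adj V V) = (\<Sum>B\<in>cliques adj V (Suc 0). real (card (common_nbrs adj V B)))"
    unfolding C1 by (subst sum.reindex) (auto simp: pair_count_def common_nbrs_def)
  also have "\<dots> = 2 * real (card (cliques adj V 2))"
    using sum_card_common_nbrs[OF assms, of "Suc 0"] by (simp add: numeral_2_eq_2)
  finally show ?thesis by linarith
qed

lemma is_clique_eq_pairwise: "is_clique E K \<longleftrightarrow> pairwise (\<lambda>u v. {u, v} \<in> E) K"
  by (simp add: is_clique_def pairwise_def)

lemma k_count_eq_card_cliques: "k_count n s E = card (cliques (\<lambda>u v. {u, v} \<in> E) {0..<n} s)"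
  by (simp add: k_count_def cliques_def is_clique_eq_pairwise)

lemma symp_edge: "symp (\<lambda>u v. {u, v} \<in> E)"
  by (simp add: symp_def insert_commute)

lemma irreflp_edge: "graph_on n E \<Longrightarrow> irreflp (\<lambda>u v. {u, v} \<in> E)"
  by (auto simp: irreflp_def graph_on_def)

text \<open>Deleting the inner edges makes \<open>c\<close> proper. They are the 2-cliques of the
  relation \<open>inner\<close>, so the handshake lemma counts them.\<close>

lemma D_r_le_pair_count:
  assumes E: "graph_on n E" and c: "\<forall>v\<in>{0..<n}. c v < r"
  shows "2 * D_r n r E \<le> pair_count (\<lambda>u v. {u, v} \<in> E \<and> c u = c v) {0..<n} {0..<n}"
proof -
  define inner where "inner u v \<longleftrightarrow> {u, v} \<in> E \<and> c u = c v" for u v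
  define F where "F = cliques inner {0..<n} 2"
  have sym: "symp inner" and irr: "irreflp inner"
    using E by (auto simp: inner_def symp_def irreflp_def insert_commute graph_on_def)
  have finE: "finite E"
    by (rule finite_subset[of _ "Pow {0..<n}"]) (use E in \<open>auto simp: graph_on_def\<close>)
  have FE: "F \<subseteq> E"
    by (auto simp: F_def cliques_def card_2_iff pairwise_insert inner_def)
  have "r_partite n r (E - F)"
    unfolding r_partite_def
  proof (intro exI[of _ c] conjI c ballI impI)
    fix e u v assume e: "e \<in> E - F" and uv: "u \<in> e" "v \<in> e" "u \<noteq> v"
    have e2: "e \<subseteq> {0..<n}" "card e = 2" using e E by (auto simp: graph_on_def)
    then have euv: "e = {u, v}" using uv by (auto simp: card_2_iff)
    show "c u \<noteq> c v"
    proof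
      assume "c u = c v"
      then have "pairwise inner e"
        using e by (auto simp: euv pairwise_insert inner_def insert_commute)
      then show False using e e2 by (simp add: F_def cliques_def)
    qed
  qed
  then have "D_r n r E \<le> card F"
    unfolding D_r_def
    using FE finE by (intro Min_le) (auto intro: finite_subset[of _ "card ` Pow E"])
  moreover have "2 * card F = pair_count inner {0..<n} {0..<n}"
    unfolding F_def by (rule pair_count_eq_card_cliques_2[OF sym irr, symmetric]) simp
  ultimately show ?thesis by (simp add: inner_def[abs_def])
qed

lemma D_r_le_of_many_edges:
  fixes r :: nat and \<epsilon> :: real
  assumes r: "2 \<le> r" and \<epsilon>: "0 < \<epsilon>"
  shows "\<exists>d>0. \<forall>\<delta>. 0 < \<delta> \<and> \<delta> < d \<longrightarrow> (\<forall>n\<ge>1. \<forall>E. graph_on n E \<and> Kfree n (r + 1) E \<and>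
      real (k_count n 2 E) \<ge> real (r choose 2) * (real n / real r)\<^sup>2 - \<delta> * (real n)\<^sup>2 \<longrightarrow>
      real (D_r n r E) \<le> (2 * real r / (3 * sqrt 3) + \<epsilon>) * \<delta> powr (3 / 2) * (real n)\<^sup>2)"
proof -
  obtain d where d: "d > 0" and sharp: "\<And>\<eta> (V :: nat set) adj. 0 < \<eta> \<Longrightarrow> \<eta> < d \<Longrightarrow>
    finite V \<Longrightarrow> V \<noteq> {} \<Longrightarrow> symp adj \<Longrightarrow> irreflp adj \<Longrightarrow>
    \<forall>K\<subseteq>V. card K = Suc r \<longrightarrow> \<not> pairwise adj K \<Longrightarrow>
    real (pair_count adj V V) \<ge> (1 - 1 / r) * (real (card V))\<^sup>2 - 2 * \<eta>\<^sup>2 * (real (card V))\<^sup>2 \<Longrightarrow>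
    \<exists>c :: nat \<Rightarrow> nat. (\<forall>v\<in>V. c v < r) \<and>
      real (pair_count (\<lambda>u v. adj u v \<and> c u = c v) V V) / 2
        \<le> (2 * real r / (3 * sqrt 3) + \<epsilon>) * \<eta> ^ 3 * (real (card V))\<^sup>2"
    using ex_colouring_few_inner_edges_sharp[OF r \<epsilon>, where 'a = nat] by blast
  show ?thesis
  \<comment> \<open>The sharp bound is used with \<open>\<eta> = sqrt \<delta>\<close>, so the
    threshold is squared.\<close>
  proof (intro exI[of _ "d\<^sup>2"] conjI allI impI; (elim conjE)?)
    show "0 < d\<^sup>2" using d by simp
    fix \<delta> :: real and n E
    assume \<delta>: "0 < \<delta>" "\<delta> < d\<^sup>2" and n: "1 \<le> n" and E: "graph_on n E" "Kfree n (r + 1) E"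
      and k: "real (k_count n 2 E) \<ge> real (r choose 2) * (real n / real r)\<^sup>2 - \<delta> * (real n)\<^sup>2"
    let ?adj = "\<lambda>u v. {u, v} \<in> E"
    have free: "\<forall>K\<subseteq>{0..<n}. card K = Suc r \<longrightarrow> \<not> pairwise ?adj K"
      using E(2) by (auto simp: Kfree_def is_clique_eq_pairwise)
    have \<eta>: "0 < sqrt \<delta>" "sqrt \<delta> < d" "(sqrt \<delta>)\<^sup>2 = \<delta>"
      using \<delta> d by (auto intro: real_less_lsqrt)
    have ch: "real (r choose 2) = real r * (real r - 1) / 2"
      using r by (simp add: choose_two real_of_nat_div of_nat_diff)
    have "2 * (real (r choose 2) * (real n / real r)\<^sup>2) = (1 - 1 / r) * (real n)\<^sup>2"
      unfolding ch using r by (simp add: field_simps power2_eq_square)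
    then have "real (pair_count ?adj {0..<n} {0..<n}) \<ge> (1 - 1 / r) * (real n)\<^sup>2 - 2 * \<delta> * (real n)\<^sup>2"
      using k pair_count_eq_card_cliques_2[OF symp_edge irreflp_edge[OF E(1)], of "{0..<n}"]
      by (simp add: k_count_eq_card_cliques)
    then obtain c :: "nat \<Rightarrow> nat" where c: "\<forall>v\<in>{0..<n}. c v < r"
      "real (pair_count (\<lambda>u v. ?adj u v \<and> c u = c v) {0..<n} {0..<n}) / 2
        \<le> (2 * real r / (3 * sqrt 3) + \<epsilon>) * sqrt \<delta> ^ 3 * (real n)\<^sup>2"
      using sharp[OF \<eta>(1,2) _ _ symp_edge irreflp_edge[OF E(1)] free] n \<eta>(3) by auto
    have "sqrt \<delta> ^ 3 = \<delta> powr (3 / 2)"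
      using \<delta> by (simp add: powr_half_sqrt[symmetric] powr_powr flip: powr_numeral)
    then show "real (D_r n r E) \<le> (2 * real r / (3 * sqrt 3) + \<epsilon>) * \<delta> powr (3 / 2) * (real n)\<^sup>2"
      using c(2) D_r_le_pair_count[OF E(1) c(1)] by simp
  qed
qed

section \<open>From cliques of size \<open>s\<close> to edges\<close>

text \<open>Divide \<open>card_cliques_le_card_edges\<close> by the positive factor
  \<open>(r choose s) * (n / r) ^ (s - 2)\<close>. The new deficit stays linear in
  \<open>\<delta>\<close>, and is \<open>\<delta>\<close> itself for \<open>s = 2\<close>.\<close>

lemma k_count_2_ge_of_k_count_ge:
  assumes r: "2 \<le> s" "s \<le> r" and n: "1 \<le> n" and E: "graph_on n E" "Kfree n (r + 1) E"
    and k: "real (k_count n s E) \<ge> real (r choose s) * (real n / real r) ^ s - \<delta> * real n ^ s"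
  shows "real (k_count n 2 E) \<ge> real (r choose 2) * (real n / real r)\<^sup>2
    - (real (r choose 2) * real r ^ (s - 2) / real (r choose s) * \<delta>) * (real n)\<^sup>2"
proof -
  define a b where "a = real (r choose 2)" and "b = real (r choose s)"
  define x where "x = (real n / r) ^ (s - 2)"
  have b: "b > 0" using r by (simp add: b_def zero_less_binomial)
  have x: "x > 0" using r n by (simp add: x_def)
  have free: "cliques (\<lambda>u v. {u, v} \<in> E) {0..<n} (Suc r) = {}"
    using E(2) by (auto simp: Kfree_def is_clique_eq_pairwise cliques_def)
  have s: "s = 2 + (s - 2)" using r by simp
  have "(b * (real n / r) ^ s - \<delta> * real n ^ s) * a \<le> real (k_count n s E) * a"
    using k by (intro mult_right_mono) (auto simp: a_def b_def)
  also have "\<dots> \<le> k_count n 2 E * b * x"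
    using card_cliques_le_card_edges[OF symp_edge irreflp_edge[OF E(1)] _ free r]
    by (simp add: k_count_eq_card_cliques a_def b_def x_def)
  finally have le: "(b * (real n / r) ^ s - \<delta> * real n ^ s) * a \<le> k_count n 2 E * b * x" .
  have ns: "real n ^ s = (real n)\<^sup>2 * (real r ^ (s - 2) * x)"
    using r by (subst s, subst power_add) (simp add: x_def power_divide)
  have nrs: "(real n / r) ^ s = (real n / r)\<^sup>2 * x"
    unfolding x_def by (subst s, subst power_add) simp
  have "(a * (real n / r)\<^sup>2 - (a * real r ^ (s - 2) / b * \<delta>) * (real n)\<^sup>2) * (b * x)
      = (b * (real n / r) ^ s - \<delta> * real n ^ s) * a"
    unfolding ns nrs using b by (simp add: field_simps)
  also have "\<dots> \<le> k_count n 2 E * (b * x)" using le by (simp add: mult.assoc)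
  finally show ?thesis using b x unfolding a_def b_def by (subst (asm) mult_le_cancel_right_pos) auto
qed

section \<open>The vanishing error term and the conclusion\<close>

text \<open>Merges the thresholds for all fixed errors \<open>e\<close> into one error function of
  \<open>\<delta>\<close>.\<close>

lemma ex_error_function:
  fixes Q :: "real \<Rightarrow> real \<Rightarrow> bool"
  assumes mono: "\<And>e e' \<delta>. Q e \<delta> \<Longrightarrow> e \<le> e' \<Longrightarrow> Q e' \<delta>"
    and ev: "\<And>e. 0 < e \<Longrightarrow> \<exists>d>0. \<forall>\<delta>. 0 < \<delta> \<and> \<delta> < d \<longrightarrow> Q e \<delta>"
  shows "\<exists>f. (f \<longlongrightarrow> 0) (at_right 0) \<and> (\<exists>d>0. \<forall>\<delta>. 0 < \<delta> \<and> \<delta> \<le> d \<longrightarrow> Q (f \<delta>) \<delta>)"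
proof -
  define A where "A \<delta> = {e. 0 < e \<and> Q e \<delta>}" for \<delta>
  \<comment> \<open>The infimum of the admissible errors need not be admissible; adding
    \<open>\<delta>\<close> puts an admissible error below \<open>f \<delta>\<close> and does not
    affect the limit.\<close>
  define f where "f \<delta> = Inf (A \<delta>) + \<delta>" for \<delta>
  have bdd: "bdd_below (A \<delta>)" for \<delta> by (rule bdd_belowI[of _ 0]) (auto simp: A_def)
  have nonneg: "0 \<le> Inf (A \<delta>)" if "A \<delta> \<noteq> {}" for \<delta>
    using that by (intro cInf_greatest) (auto simp: A_def)
  obtain d where d: "d > 0" "\<And>\<delta>. 0 < \<delta> \<Longrightarrow> \<delta> < d \<Longrightarrow> Q 1 \<delta>" using ev[of 1] by auto
  have "Q (f \<delta>) \<delta>" if \<delta>: "0 < \<delta>" "\<delta> \<le> d / 2" for \<delta>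
  proof -
    have "A \<delta> \<noteq> {}" using d(2)[of \<delta>] \<delta> d(1) by (auto simp: A_def intro!: exI[of _ 1])
    then obtain e where "e \<in> A \<delta>" "e < f \<delta>" using cInf_lessD[of "A \<delta>" "f \<delta>"] \<delta> by (auto simp: f_def)
    then show ?thesis using mono[of e \<delta> "f \<delta>"] by (auto simp: A_def)
  qed
  moreover have "(f \<longlongrightarrow> 0) (at_right 0)"
  proof (rule tendstoI)
    fix e :: real assume e: "e > 0"
    obtain d where d: "d > 0" "\<And>\<delta>. 0 < \<delta> \<Longrightarrow> \<delta> < d \<Longrightarrow> Q (e / 2) \<delta>"
      using ev[of "e / 2"] e by auto
    have "dist (f \<delta>) 0 < e" if \<delta>: "0 < \<delta>" "\<delta> < min d (e / 2)" for \<delta>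
    proof -
      have mem: "e / 2 \<in> A \<delta>" using d(2)[of \<delta>] \<delta> e by (simp add: A_def)
      then have "Inf (A \<delta>) \<le> e / 2" by (intro cInf_lower bdd)
      moreover have "0 \<le> Inf (A \<delta>)" using mem by (intro nonneg) auto
      ultimately show ?thesis using \<delta> by (simp add: f_def dist_real_def)
    qed
    then show "\<forall>\<^sub>F \<delta> in at_right 0. dist (f \<delta>) 0 < e"
      unfolding eventually_at_right_field using d(1) e by (intro exI[of _ "min d (e / 2)"]) auto
  qed
  ultimately show ?thesis using d(1) by (intro exI[of _ f] conjI exI[of _ "d / 2"]) auto
qed

text \<open>For \<open>s = 2\<close> the sharp edge bound applies directly.  For \<open>s \<ge> 3\<close> the edge deficit is still
  linear in \<open>\<delta>\<close>, so the resulting bound of order \<open>\<delta> powr (3/2)\<close> is of lower order than the claim.\<close>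

lemma D_r_le_of_many_cliques:
  fixes r s :: nat and \<epsilon> :: real
  assumes r: "2 \<le> r" "2 \<le> s" "s \<le> r" and \<epsilon>: "0 < \<epsilon>"
  defines "C \<equiv> real (r choose 2) powr (3/2) / real (r choose s) powr (3 / real s)"
  shows "\<exists>d>0. \<forall>\<delta>. 0 < \<delta> \<and> \<delta> < d \<longrightarrow> (\<forall>n\<ge>1. \<forall>E. graph_on n E \<and> Kfree n (r + 1) E \<and>
      real (k_count n s E) \<ge> real (r choose s) * (real n / real r) ^ s - \<delta> * real n ^ s \<longrightarrow>
      real (D_r n r E) \<le> (2 * real r / (3 * sqrt 3) + \<epsilon>) * C * \<delta> powr (3 / real s) * (real n)\<^sup>2)"
proof -
  define A where "A = real (r choose 2) * real r ^ (s - 2) / real (r choose s)"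
  define c0 where "c0 = 2 * real r / (3 * sqrt 3)"
  have ch: "0 < r choose 2" "0 < r choose s" using r by (simp_all add: zero_less_binomial)
  have A: "A > 0" using ch r by (simp add: A_def)
  have C: "C > 0" using ch by (simp add: C_def)
  have c0: "c0 > 0" using r by (simp add: c0_def)
  obtain d where d: "d > 0" and edge: "\<And>\<delta> n E. 0 < \<delta> \<Longrightarrow> \<delta> < d \<Longrightarrow> 1 \<le> n \<Longrightarrow> graph_on n E \<Longrightarrow>
      Kfree n (r + 1) E \<Longrightarrow>
      real (k_count n 2 E) \<ge> real (r choose 2) * (real n / real r)\<^sup>2 - \<delta> * (real n)\<^sup>2 \<Longrightarrow>
      real (D_r n r E) \<le> (c0 + \<epsilon>) * \<delta> powr (3 / 2) * (real n)\<^sup>2"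
    using D_r_le_of_many_edges[OF r(1) \<epsilon>] unfolding c0_def by blast
  have "\<exists>d'>0. \<forall>\<delta>. 0 < \<delta> \<and> \<delta> < d' \<longrightarrow> (A * \<delta>) powr (3 / 2) \<le> C * \<delta> powr (3 / real s)"
  proof (cases "s = 2")
    case True
    then have "A = 1" "C = 1" using ch by (simp_all add: A_def C_def)
    then show ?thesis using True by (intro exI[of _ 1]) simp
  next
    case False
    \<comment> \<open>The surplus exponent \<open>3 / 2 - 3 / s\<close> is positive, so for small
      \<open>\<delta>\<close> the surplus power absorbs the constant
      \<open>A powr (3 / 2)\<close>.\<close>
    then have "3 / real s < 3 / 2" using r by (simp add: field_simps)
    then have "((\<lambda>\<delta>. \<delta> powr (3 / 2 - 3 / real s)) \<longlongrightarrow> 0 powr (3 / 2 - 3 / real s)) (at_right 0)"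
      by (intro tendsto_powr' tendsto_intros) (auto simp: eventually_at_right_less intro: eventually_mono[OF eventually_at_right_less])
    then have "((\<lambda>\<delta>. A powr (3 / 2) * \<delta> powr (3 / 2 - 3 / real s)) \<longlongrightarrow> A powr (3 / 2) * 0) (at_right 0)"
      by (intro tendsto_intros) simp
    then have "\<forall>\<^sub>F \<delta> in at_right 0. A powr (3 / 2) * \<delta> powr (3 / 2 - 3 / real s) < C"
      by (rule order_tendstoD) (use C in simp)
    then obtain d' where d': "d' > 0"
      "\<And>\<delta>. 0 < \<delta> \<Longrightarrow> \<delta> < d' \<Longrightarrow> A powr (3 / 2) * \<delta> powr (3 / 2 - 3 / real s) < C"
      unfolding eventually_at_right_field by auto
    have "(A * \<delta>) powr (3 / 2) \<le> C * \<delta> powr (3 / real s)" if \<delta>: "0 < \<delta>" "\<delta> < d'" for \<delta>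
    proof -
      have "(A * \<delta>) powr (3 / 2) = A powr (3 / 2) * \<delta> powr (3 / 2 - 3 / real s) * \<delta> powr (3 / real s)"
        using A \<delta> by (simp add: powr_mult mult.assoc flip: powr_add)
      also have "\<dots> \<le> C * \<delta> powr (3 / real s)"
        using d'(2)[OF \<delta>] by (intro mult_right_mono) auto
      finally show ?thesis .
    qed
    then show ?thesis using d'(1) by blast
  qed
  then obtain d' where d': "d' > 0"
    "\<And>\<delta>. 0 < \<delta> \<Longrightarrow> \<delta> < d' \<Longrightarrow> (A * \<delta>) powr (3 / 2) \<le> C * \<delta> powr (3 / real s)" by blast
  show ?thesis
  proof (intro exI[of _ "min d' (d / A)"] conjI allI impI; (elim conjE)?)
    show "0 < min d' (d / A)" using d d'(1) A by simp
    fix \<delta> :: real and n E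
    assume \<delta>: "0 < \<delta>" "\<delta> < min d' (d / A)" and n: "1 \<le> n"
      and E: "graph_on n E" "Kfree n (r + 1) E"
      and k: "real (k_count n s E) \<ge> real (r choose s) * (real n / real r) ^ s - \<delta> * real n ^ s"
    have "real (D_r n r E) \<le> (c0 + \<epsilon>) * (A * \<delta>) powr (3 / 2) * (real n)\<^sup>2"
    proof (rule edge[OF _ _ n E])
      show "0 < A * \<delta>" "A * \<delta> < d" using \<delta> A by (simp_all add: field_simps)
      show "real (r choose 2) * (real n / real r)\<^sup>2 - A * \<delta> * (real n)\<^sup>2 \<le> real (k_count n 2 E)"
        using k_count_2_ge_of_k_count_ge[OF r(2,3) n E k] by (simp add: A_def)
    qed
    also have "\<dots> \<le> (c0 + \<epsilon>) * (C * \<delta> powr (3 / real s)) * (real n)\<^sup>2"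
      using d'(2)[of \<delta>] \<delta> c0 \<epsilon> by (intro mult_right_mono mult_left_mono) auto
    finally show "real (D_r n r E)
        \<le> (2 * real r / (3 * sqrt 3) + \<epsilon>) * C * \<delta> powr (3 / real s) * (real n)\<^sup>2"
      by (simp add: c0_def mult.assoc)
  qed
qed

theorem theorem3p6:
  fixes r s :: nat
  assumes "r \<ge> 2" and "2 \<le> s" and "s \<le> r"
  shows "\<exists>f :: real \<Rightarrow> real. (f \<longlongrightarrow> 0) (at_right 0) \<and>
    (\<exists>\<delta>0 :: real. \<delta>0 > 0 \<and> (\<exists>n0 :: nat. \<forall>n \<ge> n0. \<forall>\<delta> :: real. 0 < \<delta> \<and> \<delta> \<le> \<delta>0 \<longrightarrow>
      (\<forall>E. graph_on n E \<and> Kfree n (r + 1) E \<and>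
         real (k_count n s E) \<ge> real (r choose s) * (real n / real r) ^ s - \<delta> * real n ^ s
       \<longrightarrow> real (D_r n r E) \<le>
         (2 * real r / (3 * sqrt 3) + f \<delta>) * (real (r choose 2) powr (3/2) / real (r choose s) powr (3 / real s))
           * \<delta> powr (3 / real s) * real n ^ 2)))"
proof -
  define C where "C = real (r choose 2) powr (3/2) / real (r choose s) powr (3 / real s)"
  \<comment> \<open>All \<open>n\<close> and \<open>E\<close> are quantified inside
    \<open>Q\<close>, so the error function obtained depends on \<open>r\<close>, \<open>s\<close>
    and \<open>\<delta>\<close> only; \<open>n0 = 1\<close> suffices.\<close>
  define Q where "Q e \<delta> \<longleftrightarrow> (\<forall>n\<ge>1. \<forall>E. graph_on n E \<and> Kfree n (r + 1) E \<and>
      real (k_count n s E) \<ge> real (r choose s) * (real n / real r) ^ s - \<delta> * real n ^ s \<longrightarrow>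
      real (D_r n r E) \<le> (2 * real r / (3 * sqrt 3) + e) * C * \<delta> powr (3 / real s) * (real n)\<^sup>2)"
    for e \<delta>
  have "C \<ge> 0" by (simp add: C_def)
  have "Q e' \<delta>" if "Q e \<delta>" "e \<le> e'" for e e' \<delta>
  proof -
    have "(2 * real r / (3 * sqrt 3) + e) * C * \<delta> powr (3 / real s) * (real n)\<^sup>2
        \<le> (2 * real r / (3 * sqrt 3) + e') * C * \<delta> powr (3 / real s) * (real n)\<^sup>2" for n
      using that \<open>C \<ge> 0\<close> by (intro mult_right_mono) auto
    then show ?thesis using that(1) unfolding Q_def by (meson order_trans)
  qed
  moreover have "\<exists>d>0. \<forall>\<delta>. 0 < \<delta> \<and> \<delta> < d \<longrightarrow> Q e \<delta>" if "0 < e" for e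
    using D_r_le_of_many_cliques[OF assms that] unfolding Q_def C_def .
  ultimately obtain f \<delta>0 where "(f \<longlongrightarrow> 0) (at_right 0)" "\<delta>0 > 0"
    "\<And>\<delta>. 0 < \<delta> \<Longrightarrow> \<delta> \<le> \<delta>0 \<Longrightarrow> Q (f \<delta>) \<delta>"
    using ex_error_function[of Q] by blast
  then show ?thesis
    unfolding Q_def C_def by (intro exI[of _ f] conjI exI[of _ \<delta>0] exI[of _ "1 :: nat"]) auto
qed

end
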